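(* Let $T>0$ and $k\ge 0$, let $W=(W_t)_{t\ge 0}$ be a standard Wiener process, and let $Z^{(k)}=(Z^{(k)}_t)_{t\in[0,T]}$ be the Gaussian process $Z^{(k)}_t=W_{k+t}$, viewed as a random element of $L^2([0,T],dt)$. Let $(\lambda_\ell)_{\ell\ge 1}$ be the eigenvalues of the covariance operator of $Z^{(k)}$ on $L^2([0,T],dt)$, counted with multiplicity and arranged in non-increasing order. Then: (1) $\lambda_\ell\approx \ell^{-2}$, i.e. there are constants $0<c\le C<\infty$ (which may depend on $k$ and $T$) such that $c\,\ell^{-2}\le\lambda_\ell\le C\,\ell^{-2}$ for all $\ell\ge 1$; (2) the minimal quadratic $n$-quantization error satisfies $e_n(Z^{(k)})=\Theta\big((\ln n)^{-1/2}\big)$ as $n\to\infty$, i.e. there are constants $0<c'\le C'<\infty$ (which may depend on $k$ and $T$) and $n_0\ge 2$ such that $c'(\ln n)^{-1/2}\le e_n(Z^{(k)})\le C'(\ln n)^{-1/2}$ for all $n\ge n_0$.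
   Context: Covariance operator: the covariance function of $Z^{(k)}$ is $K(t,s)=\mathbb{E}(Z^{(k)}_tZ^{(k)}_s)=\min(k+t,k+s)$ for $s,t\in[0,T]$, and the covariance operator on $L^2([0,T],dt)$ is $\varphi\mapsto \int_0^T K(\cdot,s)\varphi(s)\,ds$. Thus the $\lambda_\ell$ are the eigenvalues in $\int_0^T K(t,s)\varphi(s)\,ds=\lambda\varphi(t)$, $t\in[0,T]$, $\varphi\ne 0$. Quantization error: for a random element $X$ of $H=L^2([0,T],dt)$ (with its usual norm $\|\cdot\|$) satisfying $\mathbb{E}\|X\|^2<\infty$, and $n\in\mathbb{N}$, $n\ge1$, the minimal quadratic $n$-quantization error is $$e_n(X)=\inf\Big\{\Big(\mathbb{E}\min_{a\in\alpha}\|X-a\|^2\Big)^{1/2}:\ \alpha\subset H,\ 1\le|\alpha|\le n\Big\}.$$ *)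

theory Defs
  imports "HOL-Probability.Probability" "HOL-Library.Extended_Nat"
begin

(* Filtration-free definition: W 0 = 0 and path continuity are only required almost surely,
   which covers the "for all outcomes" convention as well. *)
locale wiener_process = prob_space M for M :: "'a measure" +
  fixes W :: "real \<Rightarrow> 'a \<Rightarrow> real"
  assumes random_variable_W: "t \<ge> 0 \<Longrightarrow> random_variable borel (W t)"
    and start_zero: "AE \<omega> in M. W 0 \<omega> = 0"
    and indep_increments:
      "\<lbrakk>0 \<le> \<tau> 0; \<And>i. i < n \<Longrightarrow> \<tau> i \<le> \<tau> (Suc i)\<rbrakk> \<Longrightarrow>
        indep_vars (\<lambda>_. borel) (\<lambda>i \<omega>. W (\<tau> (Suc i)) \<omega> - W (\<tau> i) \<omega>) {..<(n::nat)}"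
    and normal_increments:
      "\<lbrakk>0 \<le> s; s < t\<rbrakk> \<Longrightarrow>
        distributed M lborel (\<lambda>\<omega>. W t \<omega> - W s \<omega>)
          (\<lambda>x. ennreal (normal_density 0 (sqrt (t - s)) x))"
    and continuous_paths: "AE \<omega> in M. continuous_on {0..} (\<lambda>t. W t \<omega>)"

(* Processes are curried with the outcome first, so that X \<omega> is the path as a function of time. *)
definition shifted_process :: "(real \<Rightarrow> 'a \<Rightarrow> real) \<Rightarrow> real \<Rightarrow> 'a \<Rightarrow> real \<Rightarrow> real" where
  "shifted_process W k = (\<lambda>\<omega> t. W (k + t) \<omega>)"

definition interval_lborel :: "real \<Rightarrow> real measure" where
  "interval_lborel T = restrict_space lborel {0..T}"

(* Elements of L^2([0,T],dt) are represented by square-integrable Borel functions; every class has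
   such a representative. Below, equality in L^2 is almost everywhere equality. *)
definition L2_space :: "real \<Rightarrow> (real \<Rightarrow> real) set" where
  "L2_space T = {f \<in> borel_measurable (interval_lborel T).
     integrable (interval_lborel T) (\<lambda>t. (f t)\<^sup>2)}"

definition L2_norm :: "real \<Rightarrow> (real \<Rightarrow> real) \<Rightarrow> real" where
  "L2_norm T f = sqrt (LINT t|interval_lborel T. (f t)\<^sup>2)"

(* No centring term: only meant for processes with mean zero. *)
definition covariance_kernel :: "'a measure \<Rightarrow> ('a \<Rightarrow> real \<Rightarrow> real) \<Rightarrow> real \<Rightarrow> real \<Rightarrow> real" where
  "covariance_kernel M X t s = (LINT \<omega>|M. X \<omega> t * X \<omega> s)"

definition covariance_operator ::
  "real \<Rightarrow> 'a measure \<Rightarrow> ('a \<Rightarrow> real \<Rightarrow> real) \<Rightarrow> (real \<Rightarrow> real) \<Rightarrow> real \<Rightarrow> real" where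
  "covariance_operator T M X \<phi> t = (LINT s|interval_lborel T. covariance_kernel M X t s * \<phi> s)"

definition eigenspace ::
  "real \<Rightarrow> ((real \<Rightarrow> real) \<Rightarrow> real \<Rightarrow> real) \<Rightarrow> real \<Rightarrow> (real \<Rightarrow> real) set" where
  "eigenspace T A \<mu> = {\<phi> \<in> L2_space T. AE t in interval_lborel T. A \<phi> t = \<mu> * \<phi> t}"

definition L2_independent :: "real \<Rightarrow> nat \<Rightarrow> (nat \<Rightarrow> real \<Rightarrow> real) \<Rightarrow> bool" where
  "L2_independent T m \<phi> \<longleftrightarrow>
     (\<forall>c :: nat \<Rightarrow> real. (AE t in interval_lborel T. (\<Sum>i<m. c i * \<phi> i t) = 0) \<longrightarrow> (\<forall>i<m. c i = 0))"

(* The dimension of the eigenspace as a subspace of L^2; it is 0 iff \<mu> is not an eigenvalue. *)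
definition eigenvalue_multiplicity ::
  "real \<Rightarrow> ((real \<Rightarrow> real) \<Rightarrow> real \<Rightarrow> real) \<Rightarrow> real \<Rightarrow> enat" where
  "eigenvalue_multiplicity T A \<mu> =
     (SUP m \<in> {m. \<exists>\<phi>. (\<forall>i<m. \<phi> i \<in> eigenspace T A \<mu>) \<and> L2_independent T m \<phi>}. enat m)"

(* Every real \<mu>, including 0, occurs exactly as often as its multiplicity. No such enumeration
   exists for an operator with infinite-dimensional kernel; the covariance operator of the shifted
   Wiener process is injective, so 0 is not an eigenvalue there. Indices start at 1. *)
definition eigenvalue_enumeration ::
  "real \<Rightarrow> ((real \<Rightarrow> real) \<Rightarrow> real \<Rightarrow> real) \<Rightarrow> (nat \<Rightarrow> real) \<Rightarrow> bool" where
  "eigenvalue_enumeration T A eig \<longleftrightarrow>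
     (\<forall>i j. 1 \<le> i \<and> i \<le> j \<longrightarrow> eig j \<le> eig i) \<and>
     (\<forall>\<mu>. finite {l. 1 \<le> l \<and> eig l = \<mu>} \<and>
          enat (card {l. 1 \<le> l \<and> eig l = \<mu>}) = eigenvalue_multiplicity T A \<mu>)"

definition ordered_eigenvalue ::
  "real \<Rightarrow> ((real \<Rightarrow> real) \<Rightarrow> real \<Rightarrow> real) \<Rightarrow> nat \<Rightarrow> real" where
  "ordered_eigenvalue T A = (SOME eig. eigenvalue_enumeration T A eig)"

(* The expectation is a nonnegative integral because, with paths continuous only almost surely, the
   integrand may agree with a measurable function only almost everywhere. It is finite
   whenever E ||X||^2 is, so enn2real loses nothing for such X. *)
definition quantization_error :: "real \<Rightarrow> 'a measure \<Rightarrow> ('a \<Rightarrow> real \<Rightarrow> real) \<Rightarrow> nat \<Rightarrow> real" where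
  "quantization_error T M X n =
     (INF \<alpha> \<in> {\<alpha>. \<alpha> \<subseteq> L2_space T \<and> finite \<alpha> \<and> 1 \<le> card \<alpha> \<and> card \<alpha> \<le> n}.
        sqrt (enn2real (\<integral>\<^sup>+ \<omega>. ennreal (MIN a\<in>\<alpha>. (L2_norm T (\<lambda>t. X \<omega> t - a t))\<^sup>2) \<partial>M)))"

end

theory Submission
  imports Defs
begin

text \<open>
  Eigenvalues. The covariance of the shifted process is \<open>k + min t s\<close>. For \<open>\<mu> \<noteq> 0\<close> an eigenfunction
  \<open>\<psi>\<close> has a continuous version, and differentiating \<open>\<mu> \<psi>(t) = \<integral> (k + min t s) \<psi>(s) ds\<close> turns the
  eigenvalue equation into \<open>\<mu> \<psi>' = P\<close>, \<open>P' = -\<psi>\<close> with \<open>P(T) = 0\<close> and \<open>\<mu> \<psi>(0) = k P(0)\<close>, where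
  \<open>P(t) = \<integral>\<^sub>t\<^sup>T \<psi>\<close>. For \<open>\<mu> < 0\<close> an integration of \<open>(\<psi> P)'\<close> leaves only \<open>\<psi> = 0\<close>. For \<open>\<mu> = 1 / w\<^sup>2\<close>
  conservation of energy forces \<open>\<psi>\<close> to be a multiple of \<open>cos (w (T - t))\<close>, and the condition at \<open>0\<close>
  says that \<open>x = w T\<close> solves \<open>cos x = \<kappa> x sin x\<close> with \<open>\<kappa> = k / T\<close>. The positive solutions are one
  \<open>x\<^sub>m\<close> in each interval \<open>(m \<pi>, m \<pi> + \<pi> / 2]\<close>. Hence all eigenvalues are simple, the \<open>l\<close>-th one is
  \<open>(T / x\<^sub>m)\<^sup>2\<close> with \<open>m = l - 1\<close>, and the location of \<open>x\<^sub>m\<close> gives the rate \<open>l\<^sup>-\<^sup>2\<close>. The value \<open>0\<close> is not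
  an eigenvalue (\<open>brownian_operator_injective\<close>), so the enumeration of the eigenvalues exists, and it
  is unique (\<open>eigenvalue_enumeration_unique\<close>).

  Lower bound for the quantization error. Cut \<open>[0, T]\<close> into \<open>m + 1\<close> pieces of length \<open>h\<close>. For each
  offset \<open>u\<close> in \<open>[0, h)\<close> the values of the process at \<open>u, u + h, u + 2 h, \<dots>\<close> form a Gaussian random
  walk, and the squared \<open>L\<^sup>2\<close> distance to a function is the integral over \<open>u\<close> of the squared Euclidean
  distance between the walk and the sampled function. So it suffices to quantize a random walk with
  \<open>m\<close> independent \<open>N(0, h)\<close> increments. If \<open>Q\<^sub>b\<close> is the squared distance of the increments to those of
  the code word \<open>b\<close>, divided by \<open>h\<close>, then \<open>E exp (-2 Q\<^sub>b) \<le> 2\<^sup>-\<^sup>m\<close>, whatever \<open>b\<close> is. Summing over the code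
  words and applying Jensen's inequality gives \<open>E min\<^sub>b Q\<^sub>b \<ge> (m ln 2 - ln n) / 2\<close>
  (\<open>random_walk_quantization_lower\<close>). The choice \<open>m \<approx> 4 ln n\<close> yields a squared error of order
  \<open>1 / ln n\<close>.

  Upper bound. On a grid of mesh \<open>h = (k + T) / m\<close> in \<open>[0, k + T]\<close>, round the values of the Wiener
  process to multiples of \<open>sqrt h\<close>. The rounded path is an integer-valued lattice path whose total
  variation exceeds \<open>4 m\<close> only on an event that is negligible, because the normalised increments have
  exponential moments. There are at most \<open>48\<^sup>m\<close> lattice paths of variation at most \<open>4 m\<close>
  (\<open>card_bounded_paths\<close>), so \<open>m\<close> of order \<open>ln n\<close> is affordable, and the squared error of order \<open>h\<close> is
  again of order \<open>1 / ln n\<close> (\<open>quantization_upper\<close>).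

  Since the paths are continuous only almost surely, the interchanges of integrals are carried out
  for a jointly measurable modification of the process.
\<close>

section \<open>Square-integrable functions on a compact interval\<close>

lemma L2_space_diff:
  assumes "f \<in> L2_space T" "g \<in> L2_space T"
  shows "(\<lambda>t. f t - g t) \<in> L2_space T"
proof -
  have [measurable]: "f \<in> borel_measurable (interval_lborel T)" "g \<in> borel_measurable (interval_lborel T)"
    using assms by (auto simp: L2_space_def)
  have "integrable (interval_lborel T) (\<lambda>t. (f t - g t)\<^sup>2)"
  proof (rule Bochner_Integration.integrable_bound)
    show "integrable (interval_lborel T) (\<lambda>t. 2 * (f t)\<^sup>2 + 2 * (g t)\<^sup>2)"
      using assms by (auto simp: L2_space_def)
    have "(f t - g t)\<^sup>2 \<le> 2 * (f t)\<^sup>2 + 2 * (g t)\<^sup>2" for t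
      using zero_le_power2[of "f t + g t"] by (simp add: power2_eq_square algebra_simps)
    then show "AE t in interval_lborel T. norm ((f t - g t)\<^sup>2) \<le> norm (2 * (f t)\<^sup>2 + 2 * (g t)\<^sup>2)"
      by simp
  qed measurable
  then show ?thesis by (simp add: L2_space_def)
qed

text \<open>Extending by zero replaces measurability on the interval by Borel measurability on the line,
  which is the form used in the product measures below.\<close>

lemma interval_lborel_measurable_iff:
  "f \<in> borel_measurable (interval_lborel T) \<longleftrightarrow>
     (\<lambda>t. f t * indicator {0..T} t :: real) \<in> borel_measurable borel"
  unfolding interval_lborel_def
  using borel_measurable_restrict_space_iff[of "{0..T}" lborel f]
  by (simp add: mult.commute)

lemma interval_lborel_measurableI:
  "f \<in> borel_measurable borel \<Longrightarrow> f \<in> borel_measurable (interval_lborel T)"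
  unfolding interval_lborel_def by (rule measurable_restrict_space1) simp

lemma finite_measure_interval_lborel: "finite_measure (interval_lborel T)"
  unfolding interval_lborel_def
  by (rule finite_measureI) (simp add: emeasure_restrict_space space_restrict_space emeasure_lborel_Icc_eq)

lemma L2_space_bounded:
  fixes f :: "real \<Rightarrow> real"
  assumes [measurable]: "f \<in> borel_measurable (interval_lborel T)"
    and b: "\<And>t. t \<in> {0..T} \<Longrightarrow> \<bar>f t\<bar> \<le> B"
  shows "f \<in> L2_space T"
proof -
  interpret finite_measure "interval_lborel T" by (rule finite_measure_interval_lborel)
  have "integrable (interval_lborel T) (\<lambda>t. (f t)\<^sup>2)"
  proof (rule integrable_const_bound)
    have "(f t)\<^sup>2 \<le> B\<^sup>2" if "t \<in> {0..T}" for t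
      using power_mono[OF b[OF that], of 2] by simp
    then show "AE t in interval_lborel T. norm ((f t)\<^sup>2) \<le> B\<^sup>2"
      by (intro AE_I2) (auto simp: interval_lborel_def space_restrict_space)
  qed measurable
  then show ?thesis by (simp add: L2_space_def)
qed

lemma L2_space_continuous:
  assumes "continuous_on {0..T} f"
  shows "f \<in> L2_space T"
proof (cases "T \<ge> 0")
  case True
  have "compact (f ` {0..T})" by (rule compact_continuous_image[OF assms]) simp
  then obtain B where "\<And>t. t \<in> {0..T} \<Longrightarrow> \<bar>f t\<bar> \<le> B"
    using compact_imp_bounded bounded_iff by (metis imageI real_norm_def)
  moreover have "f \<in> borel_measurable (interval_lborel T)"
    unfolding interval_lborel_measurable_iff
    using borel_measurable_continuous_on_indicator[OF _ assms] by (simp add: mult.commute)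
  ultimately show ?thesis by (rule L2_space_bounded[rotated]) 
next
  case False
  then have "f \<in> borel_measurable (interval_lborel T)" 
    unfolding interval_lborel_measurable_iff by simp
  then show ?thesis by (rule L2_space_bounded[of _ _ 0]) (use False in auto)
qed

lemma L2_norm_square:
  assumes "f \<in> L2_space T"
  shows "ennreal ((L2_norm T f)\<^sup>2) = (\<integral>\<^sup>+ t. ennreal ((f t)\<^sup>2) * indicator {0..T} t \<partial>lborel)"
proof -
  have "ennreal ((L2_norm T f)\<^sup>2) = ennreal (LINT t|interval_lborel T. (f t)\<^sup>2)"
    unfolding L2_norm_def by (subst real_sqrt_pow2) auto
  also have "\<dots> = (\<integral>\<^sup>+ t. ennreal ((f t)\<^sup>2) \<partial>interval_lborel T)"
    using assms by (subst nn_integral_eq_integral) (auto simp: L2_space_def)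
  also have "\<dots> = (\<integral>\<^sup>+ t. ennreal ((f t)\<^sup>2) * indicator {0..T} t \<partial>lborel)"
    unfolding interval_lborel_def by (subst nn_integral_restrict_space) auto
  finally show ?thesis .
qed

text \<open>The positive and the negative part of \<open>f\<close> have the same finite integral over every half-line, so
  the measures with these densities coincide.\<close>

lemma AE_zero_if_tail_integrals_zero:
  fixes f :: "real \<Rightarrow> real"
  assumes f: "integrable lborel f"
    and z: "\<And>t. (LINT s|lborel. f s * indicator {t<..} s) = 0"
  shows "AE s in lborel. f s = 0"
proof -
  have [measurable]: "f \<in> borel_measurable borel" using f by simp
  define N where "N g t = (\<integral>\<^sup>+ s. ennreal (g s * indicator {t<..} s) \<partial>lborel)" for g :: "real \<Rightarrow> real" and t
  have fin: "N f t < \<infinity>" "N (\<lambda>s. - f s) t < \<infinity>" for t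
  proof -
    have i: "integrable lborel (\<lambda>s. f s * indicator {t<..} s)"
      using f by (rule integrable_real_mult_indicator[rotated]) simp
    then show "N f t < \<infinity>" "N (\<lambda>s. - f s) t < \<infinity>"
      unfolding N_def by (auto simp: real_integrable_def less_top)
  qed
  have eq: "N f t = N (\<lambda>s. - f s) t" for t
  proof -
    have i: "integrable lborel (\<lambda>s. f s * indicator {t<..} s)"
      using f by (rule integrable_real_mult_indicator[rotated]) simp
    have "enn2real (N f t) = enn2real (N (\<lambda>s. - f s) t)"
      using z[of t] unfolding real_lebesgue_integral_def[OF i] by (simp add: N_def)
    then show ?thesis using fin[of t] by (metis ennreal_enn2real infinity_ennreal_def)
  qed
  have em: "emeasure (density lborel (\<lambda>s. ennreal (g s))) {t<..} = N g t"
    if [measurable]: "g \<in> borel_measurable borel" for g t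
    by (subst emeasure_density) (auto simp: N_def indicator_def intro!: nn_integral_cong)
  have "density lborel (\<lambda>s. ennreal (f s)) = density lborel (\<lambda>s. ennreal (- f s))"
    using fin eq by (intro measure_eqI_lessThan) (auto simp: em)
  then have "AE s in lborel. ennreal (f s) = ennreal (- f s)"
    by (intro sigma_finite_measure.density_unique[OF lborel.sigma_finite_measure_axioms]) auto
  then show ?thesis
  proof eventually_elim
    case (elim s)
    then show ?case by (cases "f s \<ge> 0") (auto simp: ennreal_neg ennreal_eq_0_iff dest: sym)
  qed
qed

lemma integral_interval_lborel:
  fixes f :: "real \<Rightarrow> real"
  shows "(LINT s|interval_lborel T. f s) = (LINT s|lborel. f s * indicator {0..T} s)"
  unfolding interval_lborel_def by (subst integral_restrict_space) (auto simp: mult.commute)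

lemma integrable_interval_lborel_iff:
  fixes f :: "real \<Rightarrow> real"
  shows "integrable (interval_lborel T) f \<longleftrightarrow> integrable lborel (\<lambda>s. f s * indicator {0..T} s)"
  unfolding interval_lborel_def by (subst integrable_restrict_space) (auto simp: mult.commute)

lemma AE_interval_lborel_iff:
  "(AE t in interval_lborel T. P t) \<longleftrightarrow> (AE t in lborel. t \<in> {0..T} \<longrightarrow> P t)"
  unfolding interval_lborel_def by (subst AE_restrict_space_iff) auto

lemma space_interval_lborel: "space (interval_lborel T) = {0..T}"
  by (simp add: interval_lborel_def space_restrict_space)

lemma L2_space_integrable:
  assumes "f \<in> L2_space T"
  shows "integrable (interval_lborel T) f"
proof -
  interpret finite_measure "interval_lborel T" by (rule finite_measure_interval_lborel)
  have [measurable]: "f \<in> borel_measurable (interval_lborel T)" and i: "integrable (interval_lborel T) (\<lambda>t. (f t)\<^sup>2)"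
    using assms by (auto simp: L2_space_def)
  show ?thesis
  proof (rule Bochner_Integration.integrable_bound)
    show "integrable (interval_lborel T) (\<lambda>t. 1 + (f t)\<^sup>2)" using i by simp
    have "\<bar>x\<bar> \<le> 1 + x\<^sup>2" for x :: real
      using zero_le_power2[of "\<bar>x\<bar> - 1 / 2"] by (simp add: power2_diff power_divide)
    then show "AE t in interval_lborel T. norm (f t) \<le> norm (1 + (f t)\<^sup>2)" by simp
  qed measurable
qed

text \<open>The zero set is closed, and a closed set containing almost every point of an open set contains
  all of it.\<close>

lemma AE_interval_continuous_zero:
  assumes "0 < T" and g: "continuous_on UNIV g" and z: "AE t in interval_lborel T. g t = (0 :: real)" and t: "t \<in> {0..T}"
  shows "g t = 0"
proof -
  have C: "closed {t. g t = 0}"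
    using continuous_closed_preimage_constant[OF g closed_UNIV, of 0] by simp
  have ae: "AE t in lebesgue. t \<in> {0<..<T} \<longrightarrow> t \<in> {t. g t = 0}"
    using AE_completion[OF z[unfolded AE_interval_lborel_iff]] by eventually_elim auto
  have "{0<..<T} \<subseteq> {t. g t = 0}"
    using mem_closed_if_AE_lebesgue_open[OF open_greaterThanLessThan C ae] by blast
  then have "closure {0<..<T} \<subseteq> {t. g t = 0}" using C by (rule closure_minimal)
  then show ?thesis using assms(1) t by auto
qed

section \<open>Eigenvalue multiplicities and enumerations\<close>

lemma eigenvalue_multiplicity_zero:
  assumes z: "\<And>f. f \<in> eigenspace T A \<mu> \<Longrightarrow> AE t in interval_lborel T. f t = 0"
  shows "eigenvalue_multiplicity T A \<mu> = 0"
proof -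
  have "m = 0" if "\<forall>i<m. \<phi> i \<in> eigenspace T A \<mu>" "L2_independent T m \<phi>" for m \<phi>
  proof (rule ccontr)
    assume m: "m \<noteq> 0"
    define c where "c i = (if i = 0 then 1 else 0 :: real)" for i :: nat
    have "(\<Sum>i<m. c i * \<phi> i t) = \<phi> 0 t" for t
      using m by (simp add: c_def if_distrib[of "\<lambda>x. x * _"] cong: if_cong)
    then have "AE t in interval_lborel T. (\<Sum>i<m. c i * \<phi> i t) = 0"
      using z[of "\<phi> 0"] that m by simp
    then have "c 0 = 0" using that(2) m unfolding L2_independent_def by blast
    then show False by (simp add: c_def)
  qed
  then have "{m. \<exists>\<phi>. (\<forall>i<m. \<phi> i \<in> eigenspace T A \<mu>) \<and> L2_independent T m \<phi>} = {0}"
    by (auto simp: L2_independent_def)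
  then show ?thesis unfolding eigenvalue_multiplicity_def by (simp add: zero_enat_def)
qed

text \<open>Two elements \<open>a e\<close> and \<open>b e\<close> of the eigenspace satisfy the nontrivial relation
  \<open>b (a e) - a (b e) = 0\<close>, unless \<open>a = b = 0\<close>, when every relation holds.\<close>

lemma eigenvalue_multiplicity_one:
  assumes e: "e \<in> eigenspace T A \<mu>" and nz: "\<not> (AE t in interval_lborel T. e t = 0)"
    and span: "\<And>f. f \<in> eigenspace T A \<mu> \<Longrightarrow> \<exists>c. AE t in interval_lborel T. f t = c * e t"
  shows "eigenvalue_multiplicity T A \<mu> = 1"
proof -
  have le: "m \<le> 1" if \<phi>: "\<forall>i<m. \<phi> i \<in> eigenspace T A \<mu>" "L2_independent T m \<phi>" for m \<phi>
  proof (rule ccontr)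
    assume "\<not> m \<le> 1"
    then have m: "0 < m" "1 < m" and I: "{..<m} = {0, 1} \<union> {2..<m}" by auto
    obtain a where a: "AE t in interval_lborel T. \<phi> 0 t = a * e t" using span \<phi>(1) m by blast
    obtain b where b: "AE t in interval_lborel T. \<phi> 1 t = b * e t" using span \<phi>(1) m by blast
    have indep: "x = 0 \<and> y = 0" if "x * a + y * b = 0" for x y
    proof -
      define c where "c i = (if i = 0 then x else if i = 1 then y else 0)" for i :: nat
      have "(\<Sum>i<m. c i * \<phi> i t) = x * \<phi> 0 t + y * \<phi> 1 t" for t
        unfolding I by (subst sum.union_disjoint) (auto simp: c_def)
      moreover have "AE t in interval_lborel T. x * \<phi> 0 t + y * \<phi> 1 t = 0"
        using a b
      proof eventually_elim
        case (elim t)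
        then have "x * \<phi> 0 t + y * \<phi> 1 t = (x * a + y * b) * e t" by (simp add: algebra_simps)
        then show ?case using that by simp
      qed
      ultimately have "\<forall>i<m. c i = 0"
        using \<phi>(2) unfolding L2_independent_def by (simp del: One_nat_def)
      then have "c 0 = 0" "c 1 = 0" using m by blast+
      then show ?thesis by (simp add: c_def)
    qed
    have "b = 0 \<and> - a = 0" by (rule indep) simp
    then have "(1 :: real) = 0 \<and> (0 :: real) = 0" by (intro indep) simp
    then show False by simp
  qed
  have "L2_independent T 1 (\<lambda>_. e)"
    unfolding L2_independent_def
  proof (intro allI impI)
    fix c :: "nat \<Rightarrow> real" and i :: nat
    assume c: "AE t in interval_lborel T. (\<Sum>i<1. c i * e t) = 0" and i: "i < 1"
    show "c i = 0"
    proof (rule ccontr)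
      assume "c i \<noteq> 0"
      then have "AE t in interval_lborel T. e t = 0" using c i by simp
      then show False using nz by simp
    qed
  qed
  then have "1 \<in> {m. \<exists>\<phi>. (\<forall>i<m. \<phi> i \<in> eigenspace T A \<mu>) \<and> L2_independent T m \<phi>}"
    using e unfolding mem_Collect_eq by (intro exI[of _ "\<lambda>_. e"]) simp
  moreover have "0 \<in> {m. \<exists>\<phi>. (\<forall>i<m. \<phi> i \<in> eigenspace T A \<mu>) \<and> L2_independent T m \<phi>}"
    by (auto simp: L2_independent_def)
  moreover have "{m. \<exists>\<phi>. (\<forall>i<m. \<phi> i \<in> eigenspace T A \<mu>) \<and> L2_independent T m \<phi>} \<subseteq> {0, 1}"
  proof
    fix m assume "m \<in> {m. \<exists>\<phi>. (\<forall>i<m. \<phi> i \<in> eigenspace T A \<mu>) \<and> L2_independent T m \<phi>}"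
    then have "m \<le> 1" using le by blast
    then show "m \<in> {0, 1}" by auto
  qed
  ultimately have "{m. \<exists>\<phi>. (\<forall>i<m. \<phi> i \<in> eigenspace T A \<mu>) \<and> L2_independent T m \<phi>} = {0, 1}"
    by blast
  then show ?thesis unfolding eigenvalue_multiplicity_def by (simp add: one_enat_def sup_max)
qed

text \<open>At the first index where two non-increasing enumerations differ, the larger of the two values
  would be listed more often by one of them than by the other, although both list it according to
  its multiplicity.\<close>

lemma eigenvalue_enumeration_unique:
  assumes A: "eigenvalue_enumeration T A eig" and B: "eigenvalue_enumeration T A eig'" and "1 \<le> l"
  shows "eig l = eig' l"
  using \<open>1 \<le> l\<close>
proof (induction l rule: less_induct)
  case (less l)
  have False if E: "eigenvalue_enumeration T A f" "eigenvalue_enumeration T A g"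
    and eq: "\<And>i. 1 \<le> i \<Longrightarrow> i < l \<Longrightarrow> f i = g i" and lt: "f l < g l" for f g
  proof -
    have sub: "{i. 1 \<le> i \<and> f i = g l} \<subset> {i. 1 \<le> i \<and> g i = g l}"
    proof
      show "{i. 1 \<le> i \<and> f i = g l} \<subseteq> {i. 1 \<le> i \<and> g i = g l}"
      proof safe
        fix i assume i: "1 \<le> i" "f i = g l"
        then have "i < l"
          using E(1) lt less.prems unfolding eigenvalue_enumeration_def by (metis leI not_less)
        then show "g i = g l" using eq[OF i(1)] i(2) by simp
      qed
      show "{i. 1 \<le> i \<and> f i = g l} \<noteq> {i. 1 \<le> i \<and> g i = g l}"
      proof -
        have "l \<in> {i. 1 \<le> i \<and> g i = g l}" using less.prems by simp
        moreover have "l \<notin> {i. 1 \<le> i \<and> f i = g l}" using lt by simp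
        ultimately show ?thesis by metis
      qed
    qed
    have "finite {i. 1 \<le> i \<and> g i = g l}"
      using E(2) unfolding eigenvalue_enumeration_def by blast
    from psubset_card_mono[OF this sub]
    have "card {i. 1 \<le> i \<and> f i = g l} < card {i. 1 \<le> i \<and> g i = g l}" .
    moreover have "enat (card {i. 1 \<le> i \<and> f i = g l}) = enat (card {i. 1 \<le> i \<and> g i = g l})"
      using E(1)[unfolded eigenvalue_enumeration_def, THEN conjunct2, THEN spec, of "g l"]
        E(2)[unfolded eigenvalue_enumeration_def, THEN conjunct2, THEN spec, of "g l"] by simp
    ultimately show False by simp
  qed
  note no = this
  have IH: "eig i = eig' i" if "1 \<le> i" "i < l" for i using less.IH[OF that(2,1)] .
  have "\<not> eig l < eig' l" using no[OF A B] IH by blast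
  moreover have "\<not> eig' l < eig l" using no[OF B A] IH[symmetric] by blast
  ultimately show ?case by simp
qed

section \<open>The integral operator with kernel k + min(t, s)\<close>

text \<open>For the shifted Wiener process this is the covariance operator; see
  \<open>ordered_eigenvalue_shifted_process\<close>.\<close>

definition brownian_operator :: "real \<Rightarrow> real \<Rightarrow> (real \<Rightarrow> real) \<Rightarrow> real \<Rightarrow> real" where
  "brownian_operator T k \<phi> t = (LINT s|interval_lborel T. (k + min t s) * \<phi> s)"

lemma brownian_kernel_integrable:
  assumes "integrable (interval_lborel T) \<phi>"
  shows "integrable (interval_lborel T) (\<lambda>s. (k + min t s) * \<phi> s)"
proof (rule Bochner_Integration.integrable_bound)
  show "integrable (interval_lborel T) (\<lambda>s. (\<bar>k\<bar> + \<bar>t\<bar> + \<bar>T\<bar>) * \<bar>\<phi> s\<bar>)"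
    using assms by (intro integrable_mult_right integrable_abs)
  have [measurable]: "\<phi> \<in> borel_measurable (interval_lborel T)" using assms by simp
  have [measurable]: "(\<lambda>s. s) \<in> borel_measurable (interval_lborel T)"
    by (rule interval_lborel_measurableI) simp
  show "(\<lambda>s. (k + min t s) * \<phi> s) \<in> borel_measurable (interval_lborel T)" by measurable
  show "AE s in interval_lborel T. norm ((k + min t s) * \<phi> s) \<le> norm ((\<bar>k\<bar> + \<bar>t\<bar> + \<bar>T\<bar>) * \<bar>\<phi> s\<bar>)"
  proof (rule AE_I2)
    fix s assume "s \<in> space (interval_lborel T)"
    then have "\<bar>k + min t s\<bar> \<le> \<bar>k\<bar> + \<bar>t\<bar> + \<bar>T\<bar>" by (auto simp: space_interval_lborel)
    then show "norm ((k + min t s) * \<phi> s) \<le> norm ((\<bar>k\<bar> + \<bar>t\<bar> + \<bar>T\<bar>) * \<bar>\<phi> s\<bar>)"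
      by (simp add: abs_mult mult_right_mono)
  qed
qed

lemma brownian_operator_diff:
  assumes "integrable (interval_lborel T) \<phi>"
  shows "brownian_operator T k \<phi> t - brownian_operator T k \<phi> u = (LINT s|interval_lborel T. (min t s - min u s) * \<phi> s)"
proof -
  have e: "(\<lambda>s. (min t s - min u s) * \<phi> s) = (\<lambda>s. (k + min t s) * \<phi> s - (k + min u s) * \<phi> s)"
    by (simp add: algebra_simps)
  show ?thesis
    unfolding brownian_operator_def e
    by (rule Bochner_Integration.integral_diff[symmetric]) (intro brownian_kernel_integrable assms)+
qed

text \<open>The kernel is Lipschitz in \<open>t\<close> uniformly in \<open>s\<close>, so the image of an integrable function is
  Lipschitz with the \<open>L\<^sup>1\<close> norm as constant.\<close>

lemma brownian_operator_continuous:
  assumes "integrable (interval_lborel T) \<phi>"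
  shows "continuous_on UNIV (brownian_operator T k \<phi>)"
proof -
  define L where "L = (LINT s|interval_lborel T. \<bar>\<phi> s\<bar>)"
  have L0: "0 \<le> L" unfolding L_def by (rule Bochner_Integration.integral_nonneg) simp
  have "dist (brownian_operator T k \<phi> t) (brownian_operator T k \<phi> u) \<le> L * dist t u" for t u
  proof -
    have "norm (LINT s|interval_lborel T. (min t s - min u s) * \<phi> s) \<le> (LINT s|interval_lborel T. dist t u * \<bar>\<phi> s\<bar>)"
    proof (rule Bochner_Integration.integral_norm_bound_integral)
      show "integrable (interval_lborel T) (\<lambda>s. (min t s - min u s) * \<phi> s)"
        using Bochner_Integration.integrable_diff[OF brownian_kernel_integrable[OF assms, of 0 t] brownian_kernel_integrable[OF assms, of 0 u]]
        by (simp add: left_diff_distrib)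
      show "integrable (interval_lborel T) (\<lambda>s. dist t u * \<bar>\<phi> s\<bar>)"
        using assms by (intro integrable_mult_right integrable_abs)
      show "norm ((min t s - min u s) * \<phi> s) \<le> dist t u * \<bar>\<phi> s\<bar>" for s
        unfolding abs_mult real_norm_def by (rule mult_right_mono) (auto simp: dist_real_def)
    qed
    then show ?thesis
      by (simp add: brownian_operator_diff[OF assms] dist_norm[of "brownian_operator T k \<phi> t"] L_def mult.commute)
  qed
  then have "L-lipschitz_on UNIV (brownian_operator T k \<phi>)"
    using L0 by (auto intro: lipschitz_onI)
  then show ?thesis by (rule lipschitz_on_continuous_on)
qed

text \<open>The derivative of the image of \<open>\<phi>\<close> at \<open>t\<close> is \<open>\<integral>\<^sub>t\<^sup>T \<phi>\<close>. If the image vanishes, so do all these tail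
  integrals, and with them \<open>\<phi>\<close>.\<close>

lemma brownian_operator_injective:
  assumes T: "0 < T" and \<phi>: "integrable (interval_lborel T) \<phi>"
    and z: "AE t in interval_lborel T. brownian_operator T k \<phi> t = 0"
  shows "AE t in interval_lborel T. \<phi> t = 0"
proof -
  have z0: "brownian_operator T k \<phi> t = 0" if "t \<in> {0..T}" for t
    using AE_interval_continuous_zero[OF T brownian_operator_continuous[OF \<phi>] z that] .
  have tail: "(LINT s|interval_lborel T. \<phi> s * indicator {t<..} s) = 0" if t: "0 \<le> t" "t < T" for t
  proof -
    \<comment> \<open>The quotients \<open>q n\<close> below are difference quotients of the kernel in \<open>t\<close> with step \<open>h n\<close>; they are dominated by \<open>1\<close> and converge to an indicator.\<close>
    define h where "h n = (T - t) / real (Suc n)" for n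
    have h: "0 < h n" "h n \<le> T - t" for n
      using t by (auto simp: h_def divide_le_eq mult_le_cancel_left1)
    define q where "q n s = (min (t + h n) s - min t s) / h n" for n s
    have [measurable]: "\<phi> \<in> borel_measurable (interval_lborel T)" using \<phi> by simp
    have [measurable]: "(\<lambda>s. s) \<in> borel_measurable (interval_lborel T)"
      by (rule interval_lborel_measurableI) simp
    have "(\<lambda>n. LINT s|interval_lborel T. q n s * \<phi> s) \<longlonglongrightarrow> (LINT s|interval_lborel T. \<phi> s * indicator {t<..} s)"
    proof (rule integral_dominated_convergence[where w = "\<lambda>s. \<bar>\<phi> s\<bar>"])
      show "(\<lambda>s. \<phi> s * indicator {t<..} s) \<in> borel_measurable (interval_lborel T)" by measurable
      show "(\<lambda>s. q n s * \<phi> s) \<in> borel_measurable (interval_lborel T)" for n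
        unfolding q_def by measurable
      show "integrable (interval_lborel T) (\<lambda>s. \<bar>\<phi> s\<bar>)" using \<phi> by (rule integrable_abs)
      have "\<bar>q n s\<bar> \<le> 1" for n s
        using h[of n] by (auto simp: q_def abs_divide divide_le_eq min_def)
      then show "AE s in interval_lborel T. norm (q n s * \<phi> s) \<le> \<bar>\<phi> s\<bar>" for n
        by (auto simp: abs_mult mult_left_le_one_le)
      show "AE s in interval_lborel T. (\<lambda>n. q n s * \<phi> s) \<longlonglongrightarrow> \<phi> s * indicator {t<..} s"
      proof (rule AE_I2)
        fix s
        show "(\<lambda>n. q n s * \<phi> s) \<longlonglongrightarrow> \<phi> s * indicator {t<..} s"
        proof (cases "s \<le> t")
          case True
          then have "q n s = 0" for n using h[of n] by (auto simp: q_def)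
          then show ?thesis using True by simp
        next
          case False
          have "h \<longlonglongrightarrow> 0"
            unfolding h_def using LIMSEQ_Suc[OF lim_const_over_n[of "T - t"]] by simp
          then have "eventually (\<lambda>n. h n < s - t) sequentially"
            using False by (intro order_tendstoD(2)) auto
          then have "eventually (\<lambda>n. q n s * \<phi> s = \<phi> s * indicator {t<..} s) sequentially"
          proof eventually_elim
            case (elim n)
            then have "q n s = 1" using h[of n] by (auto simp: q_def)
            then show ?case using False by simp
          qed
          then show ?thesis by (rule tendsto_eventually)
        qed
      qed
    qed
    moreover have "(LINT s|interval_lborel T. q n s * \<phi> s) = 0" for n
    proof -
      have "(LINT s|interval_lborel T. q n s * \<phi> s) = (LINT s|interval_lborel T. (min (t + h n) s - min t s) * \<phi> s) / h n"
        unfolding q_def times_divide_eq_left by (rule Bochner_Integration.integral_divide_zero)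
      also have "\<dots> = 0"
        using z0[of t] z0[of "t + h n"] t h[of n] brownian_operator_diff[OF \<phi>, of k "t + h n" t] by simp
      finally show ?thesis .
    qed
    ultimately show ?thesis by (simp add: LIMSEQ_const_iff)
  qed
  have "AE s in lborel. \<phi> s * indicator {0..T} s * indicator {0<..} s = 0"
  proof (rule AE_zero_if_tail_integrals_zero)
    show "integrable lborel (\<lambda>s. \<phi> s * indicator {0..T} s * indicator {0<..} s)"
      using \<phi>[unfolded integrable_interval_lborel_iff] by (rule integrable_real_mult_indicator[rotated]) simp
    fix t
    show "(LINT s|lborel. \<phi> s * indicator {0..T} s * indicator {0<..} s * indicator {t<..} s) = 0"
    proof (cases "t < T")
      case True
      have "(LINT s|lborel. \<phi> s * indicator {0..T} s * indicator {0<..} s * indicator {t<..} s)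
         = (LINT s|lborel. \<phi> s * indicator {max 0 t<..} s * indicator {0..T} s)"
        by (intro Bochner_Integration.integral_cong) (auto simp: indicator_def)
      also have "\<dots> = 0" using tail[of "max 0 t"] True T by (simp add: integral_interval_lborel)
      finally show ?thesis .
    next
      case False
      then have "\<phi> s * indicator {0..T} s * indicator {0<..} s * indicator {t<..} s = 0" for s
        by (auto simp: indicator_def)
      then show ?thesis by (simp only: Bochner_Integration.integral_zero)
    qed
  qed
  moreover have "AE s in lborel. s \<noteq> (0 :: real)" by (rule AE_lborel_singleton)
  ultimately show ?thesis
    unfolding AE_interval_lborel_iff by eventually_elim (auto simp: indicator_def split: if_splits)
qed

lemma brownian_operator_continuous_integrand:
  assumes \<psi>: "continuous_on {0..T} \<psi>" and t: "t \<in> {0..T}"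
  shows "brownian_operator T k \<psi> t =
    k * integral {0..T} \<psi> + integral {0..t} (\<lambda>s. s * \<psi> s) + t * (integral {0..T} \<psi> - integral {0..t} \<psi>)"
proof -
  have c: "continuous_on {0..T} (\<lambda>s. (k + min t s) * \<psi> s)" "continuous_on {0..t} \<psi>" "continuous_on {t..T} \<psi>"
    using t by (auto intro!: continuous_intros \<psi> intro: continuous_on_subset[OF \<psi>])
  have "brownian_operator T k \<psi> t = (LINT s:{0..T}|lborel. (k + min t s) * \<psi> s)"
    unfolding brownian_operator_def integral_interval_lborel set_lebesgue_integral_def
    by (simp add: mult.commute)
  also have "\<dots> = integral {0..T} (\<lambda>s. (k + min t s) * \<psi> s)"
    by (rule set_borel_integral_eq_integral(2)[OF borel_integrable_atLeastAtMost'[OF c(1)]])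
  also have "\<dots> = integral {0..t} (\<lambda>s. (k + min t s) * \<psi> s) + integral {t..T} (\<lambda>s. (k + min t s) * \<psi> s)"
    using t by (intro Henstock_Kurzweil_Integration.integral_combine[symmetric] integrable_continuous_real c) auto
  also have "integral {0..t} (\<lambda>s. (k + min t s) * \<psi> s) = integral {0..t} (\<lambda>s. k * \<psi> s + s * \<psi> s)"
    by (rule Henstock_Kurzweil_Integration.integral_cong) (auto simp: min_def algebra_simps)
  also have "\<dots> = k * integral {0..t} \<psi> + integral {0..t} (\<lambda>s. s * \<psi> s)"
    using c by (subst Henstock_Kurzweil_Integration.integral_add)
      (auto intro!: integrable_continuous_real continuous_intros)
  also have "integral {t..T} (\<lambda>s. (k + min t s) * \<psi> s) = integral {t..T} (\<lambda>s. (k + t) * \<psi> s)"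
    by (rule Henstock_Kurzweil_Integration.integral_cong) (auto simp: min_def)
  also have "\<dots> = (k + t) * integral {t..T} \<psi>" by simp
  also have "integral {t..T} \<psi> = integral {0..T} \<psi> - integral {0..t} \<psi>"
    using Henstock_Kurzweil_Integration.integral_combine[OF _ _ integrable_continuous_real[OF \<psi>], of t] t
    by simp
  finally show ?thesis by (simp add: algebra_simps)
qed

text \<open>The second order equation \<open>\<mu> \<psi>'' = -\<psi>\<close> with its two boundary conditions, written as a first order
  system in \<open>\<psi>\<close> and \<open>P(t) = \<integral>\<^sub>t\<^sup>T \<psi>\<close>.\<close>

lemma brownian_eigenfunction_ode:
  assumes \<psi>: "continuous_on {0..T} \<psi>" and T: "0 < T" and \<mu>: "\<mu> \<noteq> 0"
    and eig: "\<And>t. t \<in> {0..T} \<Longrightarrow> brownian_operator T k \<psi> t = \<mu> * \<psi> t"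
  obtains P where "\<And>t. t \<in> {0..T} \<Longrightarrow> (\<psi> has_real_derivative P t / \<mu>) (at t within {0..T})"
    and "\<And>t. t \<in> {0..T} \<Longrightarrow> (P has_real_derivative - \<psi> t) (at t within {0..T})"
    and "P T = 0" and "\<mu> * \<psi> 0 = k * P 0"
proof
  define P where "P t = integral {0..T} \<psi> - integral {0..t} \<psi>" for t
  have Q: "((\<lambda>t. integral {0..t} \<psi>) has_real_derivative \<psi> t) (at t within {0..T})" if "t \<in> {0..T}" for t
    using integral_has_real_derivative[OF \<psi> that] .
  have A: "((\<lambda>t. integral {0..t} (\<lambda>s. s * \<psi> s)) has_real_derivative t * \<psi> t) (at t within {0..T})" if "t \<in> {0..T}" for t
    by (rule integral_has_real_derivative[OF _ that]) (intro continuous_intros \<psi>)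
  show P: "(P has_real_derivative - \<psi> t) (at t within {0..T})" if "t \<in> {0..T}" for t
    unfolding P_def using DERIV_diff[OF DERIV_const Q[OF that]] by simp
  show "(\<psi> has_real_derivative P t / \<mu>) (at t within {0..T})" if t: "t \<in> {0..T}" for t
  proof (rule has_field_derivative_transform_within[OF _ zero_less_one t])
    show "((\<lambda>t. (k * integral {0..T} \<psi> + integral {0..t} (\<lambda>s. s * \<psi> s) + t * P t) / \<mu>) has_real_derivative P t / \<mu>) (at t within {0..T})"
      using A[OF t] P[OF t] \<mu> by (auto intro!: derivative_eq_intros)
    show "(k * integral {0..T} \<psi> + integral {0..u} (\<lambda>s. s * \<psi> s) + u * P u) / \<mu> = \<psi> u" if "u \<in> {0..T}" for u
      using brownian_operator_continuous_integrand[OF \<psi> that, of k] eig[OF that] \<mu> by (simp add: P_def field_simps)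
  qed
  show "P T = 0" by (simp add: P_def)
  show "\<mu> * \<psi> 0 = k * P 0"
    using brownian_operator_continuous_integrand[OF \<psi>, of 0 k] eig[of 0] T by (simp add: P_def)
qed

text \<open>For \<open>\<mu> < 0\<close> the function \<open>-(\<psi> P)' = \<psi>\<^sup>2 - P\<^sup>2 / \<mu>\<close> is nonnegative, while the boundary conditions
  make its integral \<open>\<psi>(0) P(0) = k P(0)\<^sup>2 / \<mu>\<close> nonpositive.\<close>

lemma brownian_no_negative_eigenvalue:
  assumes \<psi>: "continuous_on {0..T} \<psi>" and T: "0 < T" and \<mu>: "\<mu> < 0" and k: "0 \<le> k"
    and eig: "\<And>t. t \<in> {0..T} \<Longrightarrow> brownian_operator T k \<psi> t = \<mu> * \<psi> t"
    and t: "t \<in> {0..T}"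
  shows "\<psi> t = 0"
proof -
  have "\<mu> \<noteq> 0" using \<mu> by simp
  then obtain P where d: "\<And>t. t \<in> {0..T} \<Longrightarrow> (\<psi> has_real_derivative P t / \<mu>) (at t within {0..T})"
    "\<And>t. t \<in> {0..T} \<Longrightarrow> (P has_real_derivative - \<psi> t) (at t within {0..T})"
    and PT: "P T = 0" and P0: "\<mu> * \<psi> 0 = k * P 0"
    using brownian_eigenfunction_ode[OF \<psi> T _ eig] by blast
  define g where "g t = (\<psi> t)\<^sup>2 + (P t)\<^sup>2 / (- \<mu>)" for t
  have cP: "continuous_on {0..T} P" using d(2) by (rule DERIV_continuous_on)
  have cg: "continuous_on {0..T} g"
    unfolding g_def using \<mu> by (intro continuous_intros \<psi> cP) auto
  have g0: "0 \<le> g s" for s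
    unfolding g_def using \<mu> by (intro add_nonneg_nonneg divide_nonneg_nonneg) auto
  have "((\<lambda>t. - (\<psi> t * P t)) has_vector_derivative g s) (at s within {0..T})" if "s \<in> {0..T}" for s
    unfolding g_def has_real_derivative_iff_has_vector_derivative[symmetric]
    using d[OF that] by (auto intro!: derivative_eq_intros simp: power2_eq_square)
  then have "(g has_integral - (\<psi> T * P T) - - (\<psi> 0 * P 0)) {0..T}"
    using T by (intro fundamental_theorem_of_calculus) auto
  then have "integral {0..T} g = \<psi> 0 * P 0" using PT by (simp add: integral_unique)
  also have "\<psi> 0 = k * P 0 / \<mu>" using P0 \<mu> by (simp add: field_simps)
  also have "k * P 0 / \<mu> * P 0 = k * (P 0)\<^sup>2 / \<mu>" by (simp add: power2_eq_square)
  also have "\<dots> \<le> 0" using k \<mu> by (intro divide_nonneg_neg) auto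
  finally have "integral {0..T} g \<le> 0" .
  moreover have "0 \<le> integral {0..T} g"
    using g0 by (intro Henstock_Kurzweil_Integration.integral_nonneg integrable_continuous_real cg)
  ultimately have "integral {0..T} g = 0" by simp
  then have "g t = 0" using integral_eq_0_iff[OF cg T g0] t by blast
  moreover have "0 \<le> (P t)\<^sup>2 / (- \<mu>)" using \<mu> by (intro divide_nonneg_nonneg) auto
  ultimately have "(\<psi> t)\<^sup>2 \<le> 0" unfolding g_def by linarith
  then show ?thesis by simp
qed

text \<open>The system is that of a harmonic oscillator. Its solution is determined by the data at \<open>T\<close>, where
  \<open>P\<close> vanishes; the remaining boundary condition at \<open>0\<close> is the equation for \<open>w\<close>.\<close>

lemma brownian_positive_eigenfunction:
  assumes \<psi>: "continuous_on {0..T} \<psi>" and T: "0 < T" and w: "0 < w"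
    and eig: "\<And>t. t \<in> {0..T} \<Longrightarrow> brownian_operator T k \<psi> t = 1 / w\<^sup>2 * \<psi> t"
  shows "\<forall>t\<in>{0..T}. \<psi> t = \<psi> T * cos (w * (T - t))"
    and "\<psi> T = 0 \<or> cos (w * T) = k * w * sin (w * T)"
proof -
  have "1 / w\<^sup>2 \<noteq> 0" using w by simp
  then obtain P where d: "\<And>t. t \<in> {0..T} \<Longrightarrow> (\<psi> has_real_derivative P t / (1 / w\<^sup>2)) (at t within {0..T})"
    "\<And>t. t \<in> {0..T} \<Longrightarrow> (P has_real_derivative - \<psi> t) (at t within {0..T})"
    and PT: "P T = 0" and P0: "1 / w\<^sup>2 * \<psi> 0 = k * P 0"
    using brownian_eigenfunction_ode[OF \<psi> T _ eig] by blast
  \<comment> \<open>The deviation from the expected solution solves the same system with zero data at \<open>T\<close>, and its energy is constant.\<close>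
  define Y where "Y t = \<psi> t - \<psi> T * cos (w * (T - t))" for t
  define Q where "Q t = P t - \<psi> T * (sin (w * (T - t)) / w)" for t
  have dY: "(Y has_real_derivative w\<^sup>2 * Q t) (at t within {0..T})" if "t \<in> {0..T}" for t
  proof -
    have "((\<lambda>t. cos (w * (T - t))) has_real_derivative w * sin (w * (T - t))) (at t within {0..T})"
      by (auto intro!: derivative_eq_intros)
    from DERIV_diff[OF d(1)[OF that] DERIV_cmult[OF this, of "\<psi> T"]]
    have "(Y has_real_derivative P t / (1 / w\<^sup>2) - \<psi> T * (w * sin (w * (T - t)))) (at t within {0..T})"
      unfolding Y_def .
    moreover have "P t / (1 / w\<^sup>2) - \<psi> T * (w * sin (w * (T - t))) = w\<^sup>2 * Q t"
      using w by (simp add: Q_def right_diff_distrib power2_eq_square)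
    ultimately show ?thesis by (simp only:)
  qed
  have dQ: "(Q has_real_derivative - Y t) (at t within {0..T})" if "t \<in> {0..T}" for t
  proof -
    have "((\<lambda>t. sin (w * (T - t)) / w) has_real_derivative - cos (w * (T - t))) (at t within {0..T})"
      using w by (auto intro!: derivative_eq_intros)
    from DERIV_diff[OF d(2)[OF that] DERIV_cmult[OF this, of "\<psi> T"]] show ?thesis
      unfolding Y_def Q_def by simp
  qed
  have "((\<lambda>t. (Y t)\<^sup>2 + w\<^sup>2 * (Q t)\<^sup>2) has_field_derivative 0) (at t within {0..T})" if "t \<in> {0..T}" for t
    using dY[OF that] dQ[OF that] by (auto intro!: derivative_eq_intros)
  from has_field_derivative_zero_constant[OF _ this] obtain c where
    c: "\<And>t. t \<in> {0..T} \<Longrightarrow> (Y t)\<^sup>2 + w\<^sup>2 * (Q t)\<^sup>2 = c" by auto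
  have "c = 0" using c[of T] T PT by (simp add: Y_def Q_def)
  then have zero: "Y t = 0 \<and> Q t = 0" if "t \<in> {0..T}" for t
    using c[OF that] w by (simp add: add_nonneg_eq_0_iff)
  show "\<forall>t\<in>{0..T}. \<psi> t = \<psi> T * cos (w * (T - t))"
  proof
    fix t assume "t \<in> {0..T}"
    then have "Y t = 0" using zero by blast
    then show "\<psi> t = \<psi> T * cos (w * (T - t))" unfolding Y_def by linarith
  qed
  have e: "\<psi> 0 = \<psi> T * cos (w * T)" "P 0 = \<psi> T * (sin (w * T) / w)"
    using zero[of 0] T by (auto simp: Y_def Q_def)
  have "\<psi> 0 = w\<^sup>2 * k * P 0" using P0 w by (simp add: field_simps)
  then have "\<psi> T * cos (w * T) = \<psi> T * (k * w * sin (w * T))"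
    using e w by (simp add: power2_eq_square mult_ac)
  then show "\<psi> T = 0 \<or> cos (w * T) = k * w * sin (w * T)" by simp
qed

lemma brownian_cosine_eigenfunction:
  assumes T: "0 < T" and w: "0 < w" and eq: "cos (w * T) = k * w * sin (w * T)" and t: "t \<in> {0..T}"
  shows "brownian_operator T k (\<lambda>t. cos (w * (T - t))) t = 1 / w\<^sup>2 * cos (w * (T - t))"
proof -
  have I: "integral {0..u} (\<lambda>s. cos (w * (T - s))) = (sin (w * T) - sin (w * (T - u))) / w" if "0 \<le> u" for u
  proof -
    have "((\<lambda>s. cos (w * (T - s))) has_integral (- sin (w * (T - u)) / w - - sin (w * (T - 0)) / w)) {0..u}"
      using that w by (intro fundamental_theorem_of_calculus)
        (auto simp: has_real_derivative_iff_has_vector_derivative[symmetric] intro!: derivative_eq_intros)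
    then show ?thesis by (simp add: integral_unique diff_divide_distrib)
  qed
  have J: "integral {0..t} (\<lambda>s. s * cos (w * (T - s))) =
      - t * sin (w * (T - t)) / w + cos (w * (T - t)) / w\<^sup>2 - cos (w * T) / w\<^sup>2"
  proof -
    have dsin: "((\<lambda>s. sin (w * (T - s)) / w) has_real_derivative - cos (w * (T - s))) (at s within {0..t})" for s
      using w by (auto intro!: derivative_eq_intros)
    have dcos: "((\<lambda>s. cos (w * (T - s)) / w\<^sup>2) has_real_derivative sin (w * (T - s)) / w) (at s within {0..t})" for s
      using w by (auto intro!: derivative_eq_intros simp: power2_eq_square)
    have "((\<lambda>s. cos (w * (T - s)) / w\<^sup>2 - s * (sin (w * (T - s)) / w)) has_real_derivative s * cos (w * (T - s))) (at s within {0..t})" for s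
      using DERIV_diff[OF dcos DERIV_mult[OF DERIV_ident dsin], of s] by (simp add: mult.commute)
    then have "((\<lambda>s. s * cos (w * (T - s))) has_integral
        (cos (w * (T - t)) / w\<^sup>2 - t * (sin (w * (T - t)) / w)) - (cos (w * (T - 0)) / w\<^sup>2 - 0 * (sin (w * (T - 0)) / w))) {0..t}"
      using t by (intro fundamental_theorem_of_calculus)
        (auto simp: has_real_derivative_iff_has_vector_derivative[symmetric])
    then show ?thesis by (simp add: integral_unique)
  qed
  have "brownian_operator T k (\<lambda>t. cos (w * (T - t))) t =
     k * (sin (w * T) / w) + (- t * sin (w * (T - t)) / w + cos (w * (T - t)) / w\<^sup>2 - cos (w * T) / w\<^sup>2) + t * (sin (w * (T - t)) / w)"
    using t T by (subst brownian_operator_continuous_integrand)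
      (auto intro!: continuous_intros simp: I J diff_divide_distrib)
  also have "\<dots> = 1 / w\<^sup>2 * cos (w * (T - t))"
  proof -
    have "cos (w * T) / w\<^sup>2 = k * (sin (w * T) / w)"
      using w eq by (simp add: power2_eq_square)
    then show ?thesis by simp
  qed
  finally show ?thesis .
qed

section \<open>Positive solutions of \<open>cos x = \<kappa> x sin x\<close>\<close>

lemma cos_sin_shift_pi:
  "cos (y + real m * pi) = (- 1) ^ m * cos y" "sin (y + real m * pi) = (- 1) ^ m * sin y"
  by (simp_all add: cos_add sin_add)

text \<open>Where \<open>cos x \<noteq> 0\<close> this is \<open>\<kappa> x tan x = 1\<close>; the form without a quotient also covers \<open>\<kappa> = 0\<close>, when the
  solutions are the zeros of the cosine.\<close>

definition is_tan_root :: "real \<Rightarrow> real \<Rightarrow> bool" where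
  "is_tan_root \<kappa> x \<longleftrightarrow> cos x = \<kappa> * x * sin x"

lemma is_tan_root_shift:
  "is_tan_root \<kappa> (y + real m * pi) \<longleftrightarrow> cos y = \<kappa> * (y + real m * pi) * sin y"
  unfolding is_tan_root_def cos_sin_shift_pi by (simp add: mult.left_commute[of _ "(- 1) ^ m"])

lemma tan_root_exists:
  assumes "0 \<le> \<kappa>"
  shows "\<exists>y. 0 < y \<and> y \<le> pi / 2 \<and> is_tan_root \<kappa> (y + real m * pi)"
proof -
  have "\<exists>y. 0 \<le> y \<and> y \<le> pi / 2 \<and> cos y - \<kappa> * (y + real m * pi) * sin y = 0"
    using assms by (intro IVT2') (auto intro!: continuous_intros)
  then obtain y where y: "0 \<le> y" "y \<le> pi / 2" "cos y = \<kappa> * (y + real m * pi) * sin y" by auto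
  then have "y \<noteq> 0" by auto
  then show ?thesis using y by (intro exI[of _ y]) (simp add: is_tan_root_shift)
qed

text \<open>On \<open>(0, \<pi> / 2]\<close> the left side \<open>cos y\<close> decreases strictly and the right side increases.\<close>

lemma tan_root_unique:
  assumes \<kappa>: "0 \<le> \<kappa>" and y: "0 < y" "y \<le> pi / 2" "is_tan_root \<kappa> (y + real m * pi)"
    and z: "0 < z" "z \<le> pi / 2" "is_tan_root \<kappa> (z + real m * pi)"
  shows "y = z"
proof -
  have False if *: "0 < a" "a < b" "b \<le> pi / 2" "is_tan_root \<kappa> (a + real m * pi)" "is_tan_root \<kappa> (b + real m * pi)" for a b
  proof -
    have "cos b < cos a" using * by (intro cos_monotone_0_pi) auto
    moreover have "sin a \<le> sin b" using * by (intro sin_monotone_2pi_le) auto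
    moreover have "0 \<le> sin a" using * by (intro sin_ge_zero) auto
    ultimately have "\<kappa> * (a + real m * pi) * sin a \<le> \<kappa> * (b + real m * pi) * sin b"
      using * \<kappa> by (intro mult_mono mult_left_mono) (auto intro!: mult_nonneg_nonneg)
    with \<open>cos b < cos a\<close> show False using * by (simp add: is_tan_root_shift)
  qed
  then show ?thesis using y z by (metis linorder_neqE_linordered_idom)
qed

definition tan_root :: "real \<Rightarrow> nat \<Rightarrow> real" where
  "tan_root \<kappa> m = (SOME y. 0 < y \<and> y \<le> pi / 2 \<and> is_tan_root \<kappa> (y + real m * pi)) + real m * pi"

lemma tan_root:
  assumes "0 \<le> \<kappa>"
  shows "real m * pi < tan_root \<kappa> m" "tan_root \<kappa> m \<le> real m * pi + pi / 2" "is_tan_root \<kappa> (tan_root \<kappa> m)"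
  using someI_ex[OF tan_root_exists[OF assms, of m]] by (auto simp: tan_root_def)

lemma tan_root_pos:
  assumes "0 \<le> \<kappa>"
  shows "0 < tan_root \<kappa> m"
proof -
  have "0 \<le> real m * pi" by simp
  then show ?thesis using tan_root(1)[OF assms, of m] by linarith
qed

lemma tan_root_strict_mono:
  assumes \<kappa>: "0 \<le> \<kappa>"
  shows "strict_mono (tan_root \<kappa>)"
proof (rule strict_mono_Suc_iff[THEN iffD2], rule allI)
  fix m
  have "real (Suc m) * pi = real m * pi + pi" by (simp add: algebra_simps)
  then show "tan_root \<kappa> m < tan_root \<kappa> (Suc m)"
    using tan_root(2)[OF \<kappa>, of m] tan_root(1)[OF \<kappa>, of "Suc m"] pi_gt_zero by linarith
qed

text \<open>In the remaining half \<open>(m \<pi> + \<pi> / 2, (m + 1) \<pi>)\<close> of a period, \<open>cos\<close> and \<open>sin\<close> have opposite signs, and at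
  the multiples of \<open>\<pi>\<close> the sine vanishes but the cosine does not.\<close>

lemma tan_root_surj:
  assumes \<kappa>: "0 \<le> \<kappa>" and x: "0 < x" "is_tan_root \<kappa> x"
  shows "\<exists>m. x = tan_root \<kappa> m"
proof -
  define m where "m = nat \<lfloor>x / pi\<rfloor>"
  define y where "y = x - real m * pi"
  have "0 \<le> x / pi" using x by simp
  then have "real m \<le> x / pi" "x / pi < real m + 1" unfolding m_def by linarith+
  then have y: "0 \<le> y" "y < pi"
    by (auto simp: y_def le_divide_eq divide_less_eq algebra_simps)
  have r: "cos y = \<kappa> * (y + real m * pi) * sin y"
    using x unfolding is_tan_root_shift[symmetric] by (simp add: y_def)
  have "y \<noteq> 0" using r by auto
  have "y \<le> pi / 2"
  proof (rule ccontr)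
    assume "\<not> y \<le> pi / 2"
    then have "cos y < cos (pi / 2)" using y by (intro cos_monotone_0_pi) auto
    moreover have "0 \<le> \<kappa> * (y + real m * pi) * sin y"
      using \<kappa> y by (intro mult_nonneg_nonneg sin_ge_zero) auto
    ultimately show False using r by simp
  qed
  have "tan_root \<kappa> m - real m * pi = y"
    using tan_root[OF \<kappa>, of m] y \<open>y \<noteq> 0\<close> \<open>y \<le> pi / 2\<close> x
    by (intro tan_root_unique[OF \<kappa>, of _ m]) (auto simp: y_def)
  then have "x = tan_root \<kappa> m" by (simp add: y_def)
  then show ?thesis by blast
qed

section \<open>The spectrum of the operator\<close>

text \<open>An eigenfunction for \<open>\<mu> \<noteq> 0\<close> equals almost everywhere its image divided by \<open>\<mu>\<close>, which is continuous
  and satisfies the eigenvalue equation at every point.\<close>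

lemma brownian_eigenspace_continuous_version:
  assumes \<mu>: "\<mu> \<noteq> 0" and \<phi>: "\<phi> \<in> eigenspace T (brownian_operator T k) \<mu>"
  obtains \<psi> where "continuous_on {0..T} \<psi>" "AE t in interval_lborel T. \<phi> t = \<psi> t"
    "\<And>t. brownian_operator T k \<psi> t = \<mu> * \<psi> t"
proof
  have L2: "\<phi> \<in> L2_space T" and ae: "AE t in interval_lborel T. brownian_operator T k \<phi> t = \<mu> * \<phi> t"
    using \<phi> by (auto simp: eigenspace_def)
  have i: "integrable (interval_lborel T) \<phi>" using L2 by (rule L2_space_integrable)
  define \<psi> where "\<psi> t = brownian_operator T k \<phi> t / \<mu>" for t
  show c: "continuous_on {0..T} \<psi>"
    unfolding \<psi>_def using \<mu>
    by (intro continuous_intros continuous_on_subset[OF brownian_operator_continuous[OF i]]) auto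
  show eq: "AE t in interval_lborel T. \<phi> t = \<psi> t"
    using ae by eventually_elim (use \<mu> in \<open>simp add: \<psi>_def\<close>)
  have j: "integrable (interval_lborel T) \<psi>" using L2_space_integrable[OF L2_space_continuous[OF c]] .
  fix t
  have "brownian_operator T k \<psi> t = brownian_operator T k \<phi> t"
    unfolding brownian_operator_def
    by (rule integral_cong_AE)
      (use brownian_kernel_integrable[OF i, of k t] brownian_kernel_integrable[OF j, of k t] eq in auto)
  then show "brownian_operator T k \<psi> t = \<mu> * \<psi> t" using \<mu> by (simp add: \<psi>_def)
qed

lemma brownian_eigenspace_positive:
  assumes T: "0 < T" and w: "0 < w" and \<phi>: "\<phi> \<in> eigenspace T (brownian_operator T k) (1 / w\<^sup>2)"
  obtains c where "AE t in interval_lborel T. \<phi> t = c * cos (w * (T - t))"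
    and "c = 0 \<or> is_tan_root (k / T) (w * T)"
proof -
  have "1 / w\<^sup>2 \<noteq> 0" using w by simp
  then obtain \<psi> where \<psi>: "continuous_on {0..T} \<psi>" "AE t in interval_lborel T. \<phi> t = \<psi> t"
    "\<And>t. brownian_operator T k \<psi> t = 1 / w\<^sup>2 * \<psi> t"
    using brownian_eigenspace_continuous_version[OF _ \<phi>] by blast
  note f = brownian_positive_eigenfunction[OF \<psi>(1) T w \<psi>(3)]
  have "AE t in interval_lborel T. \<phi> t = \<psi> T * cos (w * (T - t))"
    using \<psi>(2) AE_space
  proof eventually_elim
    case (elim t)
    have "\<psi> t = \<psi> T * cos (w * (T - t))"
      using f(1) elim(2) unfolding space_interval_lborel by blast
    with elim(1) show ?case by (rule trans)
  qed
  moreover have "\<psi> T = 0 \<or> is_tan_root (k / T) (w * T)"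
    using f(2) T by (auto simp: is_tan_root_def)
  ultimately show thesis by (rule that)
qed

lemma cosine_in_brownian_eigenspace:
  assumes T: "0 < T" and w: "0 < w" and r: "is_tan_root (k / T) (w * T)"
  shows "(\<lambda>t. cos (w * (T - t))) \<in> eigenspace T (brownian_operator T k) (1 / w\<^sup>2)"
proof -
  have eq: "cos (w * T) = k * w * sin (w * T)" using r T by (simp add: is_tan_root_def)
  have "(\<lambda>t. cos (w * (T - t))) \<in> L2_space T"
    by (intro L2_space_continuous continuous_intros)
  moreover have "AE t in interval_lborel T. brownian_operator T k (\<lambda>t. cos (w * (T - t))) t = 1 / w\<^sup>2 * cos (w * (T - t))"
    by (rule AE_I2) (use brownian_cosine_eigenfunction[OF T w eq] in \<open>auto simp: space_interval_lborel\<close>)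
  ultimately show ?thesis by (simp add: eigenspace_def)
qed

lemma brownian_eigenvalue_multiplicity:
  assumes T: "0 < T" and k: "0 \<le> k"
  shows "eigenvalue_multiplicity T (brownian_operator T k) \<mu> =
    (if \<exists>m. \<mu> = (T / tan_root (k / T) m)\<^sup>2 then 1 else 0)"
proof (cases "\<exists>m. \<mu> = (T / tan_root (k / T) m)\<^sup>2")
  case True
  then obtain m where m: "\<mu> = (T / tan_root (k / T) m)\<^sup>2" by blast
  have \<kappa>: "0 \<le> k / T" using T k by simp
  define w where "w = tan_root (k / T) m / T"
  have w: "0 < w" "w * T = tan_root (k / T) m" "\<mu> = 1 / w\<^sup>2"
    using T tan_root_pos[OF \<kappa>, of m] by (auto simp: w_def m power_divide)
  have r: "is_tan_root (k / T) (w * T)" unfolding w by (rule tan_root(3)[OF \<kappa>])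
  have "eigenvalue_multiplicity T (brownian_operator T k) (1 / w\<^sup>2) = 1"
  proof (rule eigenvalue_multiplicity_one)
    show "(\<lambda>t. cos (w * (T - t))) \<in> eigenspace T (brownian_operator T k) (1 / w\<^sup>2)"
      by (rule cosine_in_brownian_eigenspace[OF T w(1) r])
    show "\<not> (AE t in interval_lborel T. cos (w * (T - t)) = 0)"
    proof
      assume "AE t in interval_lborel T. cos (w * (T - t)) = 0"
      then have "cos (w * (T - T)) = 0"
        using T by (intro AE_interval_continuous_zero[where g = "\<lambda>t. cos (w * (T - t))" and T = T])
          (auto intro!: continuous_intros)
      then show False by simp
    qed
    show "\<exists>c. AE t in interval_lborel T. f t = c * cos (w * (T - t))"
      if "f \<in> eigenspace T (brownian_operator T k) (1 / w\<^sup>2)" for f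
      using brownian_eigenspace_positive[OF T w(1) that] by blast
  qed
  then show ?thesis using True w by simp
next
  case False
  have \<kappa>: "0 \<le> k / T" using T k by simp
  have "eigenvalue_multiplicity T (brownian_operator T k) \<mu> = 0"
  proof (rule eigenvalue_multiplicity_zero)
    fix f assume f: "f \<in> eigenspace T (brownian_operator T k) \<mu>"
    consider "\<mu> = 0" | "\<mu> < 0" | "\<mu> > 0" by linarith
    then show "AE t in interval_lborel T. f t = 0"
    proof cases
      case 1
      then show ?thesis
        using f brownian_operator_injective[OF T L2_space_integrable, of f k] by (simp add: eigenspace_def)
    next
      case 2
      then obtain \<psi> where \<psi>: "continuous_on {0..T} \<psi>" "AE t in interval_lborel T. f t = \<psi> t"
        "\<And>t. brownian_operator T k \<psi> t = \<mu> * \<psi> t"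
        using brownian_eigenspace_continuous_version[OF _ f] by blast
      show ?thesis
        using \<psi>(2) AE_space
        by eventually_elim (use brownian_no_negative_eigenvalue[OF \<psi>(1) T 2 k \<psi>(3)] in \<open>auto simp: space_interval_lborel\<close>)
    next
      case 3
      define w where "w = 1 / sqrt \<mu>"
      have w: "0 < w" "\<mu> = 1 / w\<^sup>2" using 3 by (auto simp: w_def power_divide)
      obtain c where c: "AE t in interval_lborel T. f t = c * cos (w * (T - t))"
        "c = 0 \<or> is_tan_root (k / T) (w * T)"
        using brownian_eigenspace_positive[OF T w(1)] f w(2) by metis
      have "\<not> is_tan_root (k / T) (w * T)"
      proof
        assume "is_tan_root (k / T) (w * T)"
        then obtain m where "w * T = tan_root (k / T) m"
          using tan_root_surj[OF \<kappa>] w T by (metis mult_pos_pos)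
        then have "\<mu> = (T / tan_root (k / T) m)\<^sup>2"
          using w T by (simp add: power_divide power_mult_distrib flip: \<open>w * T = _\<close>)
        then show False using False by blast
      qed
      then show ?thesis using c by simp
    qed
  qed
  then show ?thesis using False by simp
qed

lemma brownian_eigenvalue_enumeration:
  assumes T: "0 < T" and k: "0 \<le> k"
  shows "eigenvalue_enumeration T (brownian_operator T k) (\<lambda>l. (T / tan_root (k / T) (l - 1))\<^sup>2)"
  unfolding eigenvalue_enumeration_def
proof (intro conjI allI impI)
  have \<kappa>: "0 \<le> k / T" using T k by simp
  note pos = tan_root_pos[OF \<kappa>]
  fix i j :: nat assume "1 \<le> i \<and> i \<le> j"
  then have "tan_root (k / T) (i - 1) \<le> tan_root (k / T) (j - 1)"
    by (intro monoD[OF strict_mono_mono[OF tan_root_strict_mono[OF \<kappa>]]]) auto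
  then show "(T / tan_root (k / T) (j - 1))\<^sup>2 \<le> (T / tan_root (k / T) (i - 1))\<^sup>2"
    using T pos less_imp_le[OF pos] by (intro power_mono divide_left_mono) auto
next
  have \<kappa>: "0 \<le> k / T" using T k by simp
  note pos = tan_root_pos[OF \<kappa>]
  fix \<mu>
  have inj: "m = n" if "(T / tan_root (k / T) m)\<^sup>2 = (T / tan_root (k / T) n)\<^sup>2" for m n
  proof -
    have "T / tan_root (k / T) m = T / tan_root (k / T) n"
      using that T less_imp_le[OF pos] by (simp add: power2_eq_iff_nonneg)
    then have "tan_root (k / T) m = tan_root (k / T) n"
      using T pos[of m] pos[of n] by (simp add: field_simps)
    then show ?thesis using strict_mono_eq[OF tan_root_strict_mono[OF \<kappa>]] by simp
  qed
  let ?S = "{l. 1 \<le> l \<and> (T / tan_root (k / T) (l - 1))\<^sup>2 = \<mu>}"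
  have "finite ?S \<and> enat (card ?S) = eigenvalue_multiplicity T (brownian_operator T k) \<mu>"
  proof (cases "\<exists>m. \<mu> = (T / tan_root (k / T) m)\<^sup>2")
    case True
    then obtain m where m: "\<mu> = (T / tan_root (k / T) m)\<^sup>2" by blast
    have "?S = {Suc m}"
    proof safe
      fix l assume "1 \<le> l" "\<mu> = (T / tan_root (k / T) (l - 1))\<^sup>2"
      then have "l - 1 = m" using m by (intro inj) simp
      then show "l = Suc m" using \<open>1 \<le> l\<close> by simp
    qed (use m in auto)
    then show ?thesis using True by (simp add: brownian_eigenvalue_multiplicity[OF T k] one_enat_def)
  next
    case False
    then have S: "?S = {}" by auto
    show ?thesis
      unfolding S using False by (simp add: brownian_eigenvalue_multiplicity[OF T k] zero_enat_def)
  qed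
  then show "finite ?S" "enat (card ?S) = eigenvalue_multiplicity T (brownian_operator T k) \<mu>" by auto
qed

lemma brownian_eigenvalue_bounds:
  assumes T: "0 < T" and k: "0 \<le> k"
  obtains c C where "0 < c" "c \<le> C"
    "\<And>l. 1 \<le> l \<Longrightarrow> c * real l powr (- 2) \<le> (T / tan_root (k / T) (l - 1))\<^sup>2"
    "\<And>l. 1 \<le> l \<Longrightarrow> (T / tan_root (k / T) (l - 1))\<^sup>2 \<le> C * real l powr (- 2)"
proof -
  have \<kappa>: "0 \<le> k / T" using T k by simp
  \<comment> \<open>For \<open>l = 1\<close> the smallest root is only known to be positive; for \<open>l \<ge> 2\<close> the root exceeds \<open>(l - 1) \<pi> \<ge> l\<close>.\<close>
  define \<delta> where "\<delta> = min 1 (tan_root (k / T) 0)"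
  have \<delta>: "0 < \<delta>" "\<delta> \<le> 1" using tan_root_pos[OF \<kappa>, of 0] by (auto simp: \<delta>_def)
  have lo: "\<delta> * real l \<le> tan_root (k / T) (l - 1)" if "1 \<le> l" for l
  proof (cases "l = 1")
    case True
    then show ?thesis by (simp add: \<delta>_def)
  next
    case False
    with that have l: "2 \<le> l" by simp
    have "\<delta> * real l \<le> 1 * real l" using \<delta> by (intro mult_right_mono) auto
    also have "\<dots> \<le> real (l - 1) * 2" using l by simp
    also have "\<dots> \<le> real (l - 1) * pi" using pi_ge_two by (intro mult_left_mono) auto
    also have "\<dots> \<le> tan_root (k / T) (l - 1)" using tan_root(1)[OF \<kappa>, of "l - 1"] by simp
    finally show ?thesis .
  qed
  have up: "tan_root (k / T) (l - 1) \<le> pi * real l" if "1 \<le> l" for l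
  proof -
    have "real (l - 1) * pi + pi / 2 \<le> pi * real l"
      using that by (simp add: of_nat_diff algebra_simps)
    then show ?thesis using tan_root(2)[OF \<kappa>, of "l - 1"] by linarith
  qed
  have sq: "(T / (a * real l))\<^sup>2 = (T / a)\<^sup>2 * real l powr (- 2)" if "1 \<le> l" for l a
    using that by (simp add: powr_minus powr_numeral power_divide power_mult_distrib divide_inverse power_inverse)
  show thesis
  proof (rule that[of "(T / pi)\<^sup>2" "(T / \<delta>)\<^sup>2"])
    show "0 < (T / pi)\<^sup>2" using T by simp
    show "(T / pi)\<^sup>2 \<le> (T / \<delta>)\<^sup>2"
      using T \<delta> pi_ge_two by (intro power_mono divide_left_mono) auto
  next
    fix l :: nat assume l: "1 \<le> l"
    show "(T / pi)\<^sup>2 * real l powr (- 2) \<le> (T / tan_root (k / T) (l - 1))\<^sup>2"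
      unfolding sq[OF l, symmetric] using T up[OF l] tan_root_pos[OF \<kappa>, of "l - 1"] l
      by (intro power_mono divide_left_mono) auto
    show "(T / tan_root (k / T) (l - 1))\<^sup>2 \<le> (T / \<delta>)\<^sup>2 * real l powr (- 2)"
      unfolding sq[OF l, symmetric] using T lo[OF l] tan_root_pos[OF \<kappa>, of "l - 1"] l \<delta>
      by (intro power_mono divide_left_mono) auto
  qed
qed

section \<open>Moments of the Wiener process and its covariance\<close>

context wiener_process begin

lemma increment_moments:
  assumes "0 \<le> s" "s \<le> t"
  shows "integrable M (\<lambda>\<omega>. W t \<omega> - W s \<omega>)"
    and "expectation (\<lambda>\<omega>. W t \<omega> - W s \<omega>) = 0"
    and "integrable M (\<lambda>\<omega>. (W t \<omega> - W s \<omega>)\<^sup>2)"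
    and "expectation (\<lambda>\<omega>. (W t \<omega> - W s \<omega>)\<^sup>2) = t - s"
proof -
  have "integrable M (\<lambda>\<omega>. W t \<omega> - W s \<omega>) \<and> expectation (\<lambda>\<omega>. W t \<omega> - W s \<omega>) = 0 \<and>
    integrable M (\<lambda>\<omega>. (W t \<omega> - W s \<omega>)\<^sup>2) \<and> expectation (\<lambda>\<omega>. (W t \<omega> - W s \<omega>)\<^sup>2) = t - s"
  proof (cases "s = t")
    case False
    with assms have pos: "0 < sqrt (t - s)" and d: "distributed M lborel (\<lambda>\<omega>. W t \<omega> - W s \<omega>)
          (\<lambda>x. ennreal (normal_density 0 (sqrt (t - s)) x))"
      using normal_increments[of s t] by auto
    have e: "expectation (\<lambda>\<omega>. W t \<omega> - W s \<omega>) = 0"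
      using normal_distributed_expectation[OF pos d] .
    have v: "expectation (\<lambda>\<omega>. (W t \<omega> - W s \<omega>)\<^sup>2) = t - s"
      using normal_distributed_variance[OF pos d] e assms by simp
    have 1: "integrable M (\<lambda>\<omega>. W t \<omega> - W s \<omega>)"
      using distributed_integrable[OF d, of "\<lambda>x. x"] integrable_normal_moment[OF pos, of 0 1] by simp
    have 2: "integrable M (\<lambda>\<omega>. (W t \<omega> - W s \<omega>)\<^sup>2)"
      using distributed_integrable[OF d, of "\<lambda>x. x\<^sup>2"] integrable_normal_moment[OF pos, of 0 2] by simp
    show ?thesis using e v 1 2 by simp
  qed simp
  then show "integrable M (\<lambda>\<omega>. W t \<omega> - W s \<omega>)"
    and "expectation (\<lambda>\<omega>. W t \<omega> - W s \<omega>) = 0"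
    and "integrable M (\<lambda>\<omega>. (W t \<omega> - W s \<omega>)\<^sup>2)"
    and "expectation (\<lambda>\<omega>. (W t \<omega> - W s \<omega>)\<^sup>2) = t - s" by auto
qed

text \<open>Write \<open>W\<^sub>b = W\<^sub>a + (W\<^sub>b - W\<^sub>a)\<close>; the second summand is centred and independent of \<open>W\<^sub>a\<close>.\<close>

lemma expectation_product:
  assumes "0 \<le> a" "a \<le> b"
  shows "expectation (\<lambda>\<omega>. W a \<omega> * W b \<omega>) = a"
proof -
  define \<tau> :: "nat \<Rightarrow> real" where "\<tau> i = (if i = 0 then 0 else if i = 1 then a else b)" for i
  define D where "D i \<omega> = W (\<tau> (Suc i)) \<omega> - W (\<tau> i) \<omega>" for i \<omega>
  have [measurable]: "W 0 \<in> borel_measurable M" "W a \<in> borel_measurable M" "W b \<in> borel_measurable M"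
    using random_variable_W assms by auto
  have ind: "indep_vars (\<lambda>_. borel) D {..<2}"
    unfolding D_def using indep_increments[of \<tau> 2] assms by (auto simp: \<tau>_def)
  have D0: "D 0 = (\<lambda>\<omega>. W a \<omega> - W 0 \<omega>)" and D1: "D 1 = (\<lambda>\<omega>. W b \<omega> - W a \<omega>)"
    by (auto simp: D_def \<tau>_def)
  have int: "integrable M (D i)" if "i \<in> {..<2}" for i
    using that increment_moments(1)[of 0 a] increment_moments(1)[of a b] assms
    unfolding D_def by (auto simp: \<tau>_def)
  have "{..<2} = {0, 1::nat}" by auto
  then have ID: "integrable M (\<lambda>\<omega>. D 0 \<omega> * D 1 \<omega>)" and ED: "expectation (\<lambda>\<omega>. D 0 \<omega> * D 1 \<omega>) = expectation (D 0) * expectation (D 1)"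
    using indep_vars_integrable[OF _ ind int] indep_vars_lebesgue_integral[OF _ ind int] by auto
  have "expectation (\<lambda>\<omega>. W a \<omega> * W b \<omega>) = expectation (\<lambda>\<omega>. (W a \<omega> - W 0 \<omega>)\<^sup>2 + D 0 \<omega> * D 1 \<omega>)"
    unfolding D0 D1
    by (rule integral_cong_AE) (use start_zero in \<open>auto simp: algebra_simps power2_eq_square\<close>)
  also have "\<dots> = a"
    using ID ED increment_moments[of 0 a] increment_moments(2)[of a b] assms
    by (simp add: D0 D1)
  finally show ?thesis .
qed

lemma covariance_kernel_shifted_process:
  assumes "0 \<le> k" "0 \<le> s" "0 \<le> t"
  shows "covariance_kernel M (shifted_process W k) t s = k + min t s"
proof (cases "s \<le> t")
  case True
  then show ?thesis
    using assms expectation_product[of "k + s" "k + t"]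
    by (simp add: covariance_kernel_def shifted_process_def mult.commute)
next
  case False
  then show ?thesis
    using assms expectation_product[of "k + t" "k + s"]
    by (simp add: covariance_kernel_def shifted_process_def)
qed

end

text \<open>The covariance operator agrees with the integral operator on \<open>[0, T]\<close>, hence has the same
  eigenspaces.\<close>

lemma (in wiener_process) ordered_eigenvalue_shifted_process:
  assumes T: "0 < T" and k: "0 \<le> k" and l: "1 \<le> l"
  shows "ordered_eigenvalue T (covariance_operator T M (shifted_process W k)) l = (T / tan_root (k / T) (l - 1))\<^sup>2"
proof -
  let ?C = "covariance_operator T M (shifted_process W k)" and ?B = "brownian_operator T k"
  have op: "?C \<phi> t = ?B \<phi> t" if "t \<in> {0..T}" for \<phi> t
    unfolding covariance_operator_def brownian_operator_def
    by (rule Bochner_Integration.integral_cong)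
      (use that k in \<open>auto simp: space_interval_lborel covariance_kernel_shifted_process\<close>)
  have "eigenspace T ?C \<mu> = eigenspace T ?B \<mu>" for \<mu>
    unfolding eigenspace_def by (intro Collect_cong conj_cong refl AE_cong) (auto simp: space_interval_lborel op)
  then have "eigenvalue_enumeration T ?C = eigenvalue_enumeration T ?B"
    unfolding eigenvalue_enumeration_def eigenvalue_multiplicity_def by simp
  then have o: "ordered_eigenvalue T ?C = ordered_eigenvalue T ?B"
    by (simp add: ordered_eigenvalue_def)
  have "eigenvalue_enumeration T ?B (ordered_eigenvalue T ?B)"
    unfolding ordered_eigenvalue_def by (rule someI[where P = "eigenvalue_enumeration T ?B", OF brownian_eigenvalue_enumeration[OF T k]])
  from eigenvalue_enumeration_unique[OF this brownian_eigenvalue_enumeration[OF T k] l]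
  show ?thesis by (simp add: o)
qed

section \<open>A jointly measurable modification\<close>

lemma dyadic_floor_tendsto:
  assumes "t \<ge> 0"
  shows "(\<lambda>j. real (nat \<lfloor>t * 2 ^ j\<rfloor>) / 2 ^ j) \<longlonglongrightarrow> t"
proof -
  have aux: "t - 1 / p \<le> y / p \<and> y / p \<le> t" if "p > 0" "t * p - 1 \<le> y" "y \<le> t * p" for p y
  proof -
    have "t - 1 / p = (t * p - 1) / p" using that(1) by (simp add: diff_divide_distrib)
    then show ?thesis using that by (simp add: divide_right_mono divide_le_eq)
  qed
  have b: "t - (1/2) ^ j \<le> real (nat \<lfloor>t * 2 ^ j\<rfloor>) / 2 ^ j \<and> real (nat \<lfloor>t * 2 ^ j\<rfloor>) / 2 ^ j \<le> t" for j
  proof -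
    have "t * 2 ^ j - 1 \<le> real (nat \<lfloor>t * 2 ^ j\<rfloor>)" by linarith
    moreover have "real (nat \<lfloor>t * 2 ^ j\<rfloor>) \<le> t * 2 ^ j" using assms by (simp add: of_nat_floor)
    ultimately show ?thesis
      using aux[of "2 ^ j" "real (nat \<lfloor>t * 2 ^ j\<rfloor>)"] by (simp only: power_one_over) simp
  qed
  have "(\<lambda>j. t - (1/2::real) ^ j) \<longlonglongrightarrow> t - 0"
    by (intro tendsto_intros LIMSEQ_power_zero) simp
  then have l: "(\<lambda>j. t - (1/2::real) ^ j) \<longlonglongrightarrow> t" by simp
  show ?thesis
    by (rule tendsto_sandwich[OF _ _ l tendsto_const]) (use b in \<open>blast intro: always_eventually\<close>)+
qed

context wiener_process begin

text \<open>Approximation from the left along dyadic times: each approximant depends on countably many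
  variables \<open>W t\<close> only, which makes the limit jointly measurable, and continuity of the paths makes
  the limit equal to \<open>W t\<close> for all \<open>t\<close> simultaneously, almost surely.\<close>

definition modification :: "real \<Rightarrow> 'a \<Rightarrow> real" where
  "modification t \<omega> = lim (\<lambda>j. W (real (nat \<lfloor>t * 2 ^ j\<rfloor>) / 2 ^ j) \<omega>)"

lemma modification_measurable:
  "(\<lambda>(t, \<omega>). modification t \<omega>) \<in> borel_measurable (lborel \<Otimes>\<^sub>M M)"
proof -
  have 1: "(\<lambda>p. W (real (nat \<lfloor>fst p * 2 ^ j\<rfloor>) / 2 ^ j) (snd p)) \<in> borel_measurable ((lborel :: real measure) \<Otimes>\<^sub>M M)" for j
  proof (rule measurable_compose_countable[where f = "\<lambda>i p. W (real i / 2 ^ j) (snd p)"])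
    fix i :: nat
    have [measurable]: "W (real i / 2 ^ j) \<in> borel_measurable M" by (rule random_variable_W) simp
    show "(\<lambda>p. W (real i / 2 ^ j) (snd p)) \<in> borel_measurable ((lborel :: real measure) \<Otimes>\<^sub>M M)"
      by measurable
  qed measurable
  show ?thesis
    unfolding modification_def case_prod_beta by (intro borel_measurable_lim_metric 1)
qed

lemma modification_AE: "AE \<omega> in M. \<forall>t\<ge>0. modification t \<omega> = W t \<omega>"
  using continuous_paths
proof eventually_elim
  case (elim \<omega>)
  show ?case
  proof safe
    fix t :: real assume t: "0 \<le> t"
    have "(\<lambda>j. W (real (nat \<lfloor>t * 2 ^ j\<rfloor>) / 2 ^ j) \<omega>) \<longlonglongrightarrow> W t \<omega>"
      by (rule continuous_on_tendsto_compose[OF elim dyadic_floor_tendsto[OF t]]) (use t in auto)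
    then show "modification t \<omega> = W t \<omega>"
      unfolding modification_def by (rule limI)
  qed
qed

lemma modification_shift_measurable [measurable]:
  "(\<lambda>p. modification (c + fst p) (snd p)) \<in> borel_measurable (lborel \<Otimes>\<^sub>M M)"
  using measurable_compose[OF _ modification_measurable, of "\<lambda>p. (c + fst p, snd p)" "lborel \<Otimes>\<^sub>M M"]
  by simp

lemma modification_section_measurable [measurable]:
  assumes "\<omega> \<in> space M"
  shows "(\<lambda>t. modification t \<omega>) \<in> borel_measurable borel"
  using measurable_compose[OF _ modification_measurable, of "\<lambda>t. (t, \<omega>)" "lborel"] assms
  by simp

lemma AE_continuous_modification:
  "AE \<omega> in M. \<omega> \<in> space M \<and> continuous_on {0..} (\<lambda>t. W t \<omega>) \<and> (\<forall>t\<ge>0. modification t \<omega> = W t \<omega>)"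
  using continuous_paths modification_AE AE_space by eventually_elim auto

lemma shifted_process_L2_space:
  assumes "0 \<le> k" "continuous_on {0..} (\<lambda>t. W t \<omega>)"
  shows "shifted_process W k \<omega> \<in> L2_space T"
  unfolding shifted_process_def
  by (intro L2_space_continuous continuous_on_compose2[OF assms(2)] continuous_intros)
    (use assms(1) in auto)

end

section \<open>Lower bound for the quantization error\<close>

text \<open>Integrating over a long interval amounts to integrating, over the offset \<open>u\<close> in one short interval,
  the sum of the values at \<open>u, u + h, u + 2 h, \<dots>\<close>.\<close>

lemma nn_integral_split_translates:
  fixes g :: "real \<Rightarrow> ennreal"
  assumes [measurable]: "g \<in> borel_measurable borel" and h: "0 \<le> h"
  shows "(\<integral>\<^sup>+ t. g t * indicator {0..<real n * h} t \<partial>lborel) =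
    (\<Sum>j<n. \<integral>\<^sup>+ u. g (real j * h + u) * indicator {0..<h} u \<partial>lborel)"
proof (induction n)
  case (Suc n)
  have "(\<integral>\<^sup>+ t. g t * indicator {0..<real (Suc n) * h} t \<partial>lborel) =
     (\<integral>\<^sup>+ t. g t * indicator {0..<real n * h} t + g t * indicator {real n * h..<real (Suc n) * h} t \<partial>lborel)"
  proof (rule nn_integral_cong)
    fix t
    have "0 \<le> real n * h" "real n * h \<le> real (Suc n) * h" using h by (auto intro: mult_right_mono)
    then show "g t * indicator {0..<real (Suc n) * h} t =
      g t * indicator {0..<real n * h} t + g t * indicator {real n * h..<real (Suc n) * h} t"
      by (auto simp: indicator_def)
  qed
  also have "\<dots> = (\<integral>\<^sup>+ t. g t * indicator {0..<real n * h} t \<partial>lborel) +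
      (\<integral>\<^sup>+ t. g t * indicator {real n * h..<real (Suc n) * h} t \<partial>lborel)"
    by (rule nn_integral_add) auto
  also have "(\<integral>\<^sup>+ t. g t * indicator {real n * h..<real (Suc n) * h} t \<partial>lborel) =
      (\<integral>\<^sup>+ u. g (real n * h + u) * indicator {0..<h} u \<partial>lborel)"
    by (subst nn_integral_real_affine[where c = 1 and t = "real n * h"])
      (auto intro!: nn_integral_cong simp: indicator_def algebra_simps)
  finally show ?case using Suc by simp
qed simp

context wiener_process begin

text \<open>The exponential is a constant multiple of the Gaussian density with mean \<open>\<beta>\<close> and half the standard
  deviation, and the density of the increment is bounded by its value at \<open>0\<close>. The two constants
  combine to \<open>1 / 2\<close> uniformly in \<open>\<beta>\<close>.\<close>

lemma increment_small_ball:
  assumes "0 \<le> s" "s < t"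
  shows "(\<integral>\<^sup>+ \<omega>. ennreal (exp (- 2 * (W t \<omega> - W s \<omega> - \<beta>)\<^sup>2 / (t - s))) \<partial>M) \<le> ennreal (1 / 2)"
proof -
  define \<sigma> where "\<sigma> = sqrt (t - s)"
  have s: "\<sigma> > 0" "t - s = \<sigma>\<^sup>2" using assms by (auto simp: \<sigma>_def)
  have "(\<integral>\<^sup>+ \<omega>. ennreal (exp (- 2 * (W t \<omega> - W s \<omega> - \<beta>)\<^sup>2 / (t - s))) \<partial>M) =
      (\<integral>\<^sup>+ x. ennreal (normal_density 0 \<sigma> x) * ennreal (exp (- 2 * (x - \<beta>)\<^sup>2 / (t - s))) \<partial>lborel)"
    unfolding \<sigma>_def
    by (rule distributed_nn_integral[OF normal_increments[OF assms], symmetric]) simp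
  also have "\<dots> \<le> (\<integral>\<^sup>+ x. ennreal (1 / 2) * ennreal (normal_density \<beta> (\<sigma> / 2) x) \<partial>lborel)"
  proof (rule nn_integral_mono)
    fix x
    have e: "exp (- 2 * (x - \<beta>)\<^sup>2 / (t - s)) = sqrt (2 * pi * \<sigma>\<^sup>2) / 2 * normal_density \<beta> (\<sigma> / 2) x"
      using s by (simp add: normal_density_def real_sqrt_mult real_sqrt_divide field_simps)
    have "normal_density 0 \<sigma> x \<le> 1 / sqrt (2 * pi * \<sigma>\<^sup>2)"
      using s by (simp add: normal_density_def divide_right_mono)
    then have "normal_density 0 \<sigma> x * exp (- 2 * (x - \<beta>)\<^sup>2 / (t - s)) \<le>
       1 / sqrt (2 * pi * \<sigma>\<^sup>2) * (sqrt (2 * pi * \<sigma>\<^sup>2) / 2 * normal_density \<beta> (\<sigma> / 2) x)"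
      unfolding e by (intro mult_right_mono) auto
    also have "\<dots> = 1 / 2 * normal_density \<beta> (\<sigma> / 2) x"
      using s by simp
    finally show "ennreal (normal_density 0 \<sigma> x) * ennreal (exp (- 2 * (x - \<beta>)\<^sup>2 / (t - s))) \<le>
       ennreal (1 / 2) * ennreal (normal_density \<beta> (\<sigma> / 2) x)"
      by (subst (1 2) ennreal_mult[symmetric]) (auto intro!: ennreal_leI)
  qed
  also have "\<dots> = ennreal (1 / 2)"
    using s by (subst nn_integral_cmult) (auto simp: nn_integral_eq_integral)
  finally show ?thesis .
qed

lemma random_walk_small_ball:
  assumes h: "0 < h" and "0 \<le> u"
  shows "(\<integral>\<^sup>+ \<omega>. ennreal (exp (- 2 * (\<Sum>i<m. (W (u + real (Suc i) * h) \<omega> - W (u + real i * h) \<omega> - \<beta> i)\<^sup>2) / h)) \<partial>M)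
    \<le> ennreal ((1 / 2) ^ m)"
proof -
  define \<tau> where "\<tau> i = u + real i * h" for i
  have [simp]: "0 \<le> \<tau> i" for i using assms by (simp add: \<tau>_def)
  have [simp]: "\<tau> (Suc i) - \<tau> i = h" for i by (simp add: \<tau>_def algebra_simps)
  have less: "\<tau> i < \<tau> (Suc i)" for i using h by (simp add: \<tau>_def)
  have ind: "indep_vars (\<lambda>_. borel) (\<lambda>i \<omega>. W (\<tau> (Suc i)) \<omega> - W (\<tau> i) \<omega>) {..<m}"
    using less by (intro indep_increments) (auto intro: less_imp_le)
  define E where "E i \<omega> = ennreal (exp (- 2 * (W (\<tau> (Suc i)) \<omega> - W (\<tau> i) \<omega> - \<beta> i)\<^sup>2 / h))" for i \<omega>
  have indE: "indep_vars (\<lambda>_. borel) E {..<m}"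
    unfolding E_def by (rule indep_vars_compose2[OF ind, where Y = "\<lambda>i x. ennreal (exp (- 2 * (x - \<beta> i)\<^sup>2 / h))"]) simp
  have "(\<integral>\<^sup>+ \<omega>. ennreal (exp (- 2 * (\<Sum>i<m. (W (\<tau> (Suc i)) \<omega> - W (\<tau> i) \<omega> - \<beta> i)\<^sup>2) / h)) \<partial>M)
     = (\<integral>\<^sup>+ \<omega>. (\<Prod>i<m. E i \<omega>) \<partial>M)"
    unfolding E_def
    by (simp add: prod_ennreal exp_sum[symmetric] sum_distrib_left sum_divide_distrib sum_negf)
  also have "\<dots> = (\<Prod>i<m. \<integral>\<^sup>+ \<omega>. E i \<omega> \<partial>M)"
    by (rule indep_vars_nn_integral[OF _ indE]) auto
  also have "\<dots> \<le> (\<Prod>i<m. ennreal (1 / 2))"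
  proof (rule prod_mono_ennreal)
    fix i
    show "(\<integral>\<^sup>+ \<omega>. E i \<omega> \<partial>M) \<le> ennreal (1 / 2)"
      unfolding E_def using increment_small_ball[of "\<tau> i" "\<tau> (Suc i)" "\<beta> i"] less by simp
  qed
  also have "\<dots> = ennreal ((1 / 2) ^ m)"
    by (subst prod_ennreal) simp_all
  finally show ?thesis by (simp add: \<tau>_def)
qed

text \<open>Jensen's inequality in the form of the tangent line \<open>1 + y \<le> e\<^sup>y\<close>, applied at \<open>y = s - 2 Q\<close>, where \<open>Q\<close>
  belongs to the code word nearest to the walk. Passing from positions to increments
  costs a factor \<open>4\<close>.\<close>

lemma random_walk_quantization_lower:
  fixes b :: "'b \<Rightarrow> nat \<Rightarrow> real"
  assumes h: "0 < h" and u: "0 \<le> u" and B: "finite B" "B \<noteq> {}" "card B \<le> n"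
  shows "ennreal (h / 8 * (real m * ln 2 - ln (real n))) \<le>
    (\<integral>\<^sup>+ \<omega>. ennreal (MIN a\<in>B. \<Sum>j<Suc m. (W (u + real j * h) \<omega> - b a j)\<^sup>2) \<partial>M)"
proof (cases "real m * ln 2 - ln (real n) \<ge> 0")
  case False
  then have "h / 8 * (real m * ln 2 - ln (real n)) \<le> 0"
    using h by (intro mult_nonneg_nonpos) auto
  then show ?thesis by (simp add: ennreal_neg)
next
  case True
  \<comment> \<open>The tangent point that makes \<open>e\<^sup>s n 2\<^sup>-\<^sup>m = 1\<close>.\<close>
  define s where "s = real m * ln 2 - ln (real n)"
  define \<beta> where "\<beta> a i = b a (Suc i) - b a i" for a i
  define Q where "Q a \<omega> = (\<Sum>i<m. (W (u + real (Suc i) * h) \<omega> - W (u + real i * h) \<omega> - \<beta> a i)\<^sup>2) / h" for a \<omega>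
  define R where "R \<omega> = (MIN a\<in>B. \<Sum>j<Suc m. (W (u + real j * h) \<omega> - b a j)\<^sup>2)" for \<omega>
  have n: "n \<ge> 1" using B by (metis One_nat_def Suc_leI card_gt_0_iff le_trans)
  have [measurable]: "W (u + real j * h) \<in> borel_measurable M" for j
    using random_variable_W h u by simp
  have [measurable]: "R \<in> borel_measurable M"
    unfolding R_def using B by measurable
  have Qm[measurable]: "Q a \<in> borel_measurable M" for a
    unfolding Q_def by measurable
  have small: "(\<integral>\<^sup>+ \<omega>. ennreal (exp (- 2 * Q a \<omega>)) \<partial>M) \<le> ennreal ((1 / 2) ^ m)" for a
    using random_walk_small_ball[OF h u, where m = m and \<beta> = "\<beta> a"] by (simp add: Q_def)
  have QR: "h / 4 * Q a \<omega> \<le> (\<Sum>j<Suc m. (W (u + real j * h) \<omega> - b a j)\<^sup>2)" for a \<omega>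
  proof -
    define x where "x j = W (u + real j * h) \<omega> - b a j" for j
    have "(x (Suc i) - x i)\<^sup>2 \<le> 2 * (x (Suc i))\<^sup>2 + 2 * (x i)\<^sup>2" for i
      using zero_le_power2[of "x (Suc i) + x i"] by (simp add: power2_eq_square algebra_simps)
    then have "(\<Sum>i<m. (x (Suc i) - x i)\<^sup>2) \<le> (\<Sum>i<m. 2 * (x (Suc i))\<^sup>2 + 2 * (x i)\<^sup>2)"
      by (rule sum_mono)
    also have "\<dots> = 2 * (\<Sum>i<m. (x (Suc i))\<^sup>2) + 2 * (\<Sum>i<m. (x i)\<^sup>2)"
      by (simp add: sum.distrib sum_distrib_left)
    also have "\<dots> \<le> 4 * (\<Sum>j<Suc m. (x j)\<^sup>2)"
    proof -
      have "(\<Sum>i<m. (x (Suc i))\<^sup>2) \<le> (\<Sum>j<Suc m. (x j)\<^sup>2)"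
        by (subst sum.lessThan_Suc_shift) simp
      moreover have "(\<Sum>i<m. (x i)\<^sup>2) \<le> (\<Sum>j<Suc m. (x j)\<^sup>2)" by simp
      ultimately show ?thesis by linarith
    qed
    finally have "(\<Sum>i<m. (x (Suc i) - x i)\<^sup>2) \<le> 4 * (\<Sum>j<Suc m. (x j)\<^sup>2)" .
    moreover have "Q a \<omega> = (\<Sum>i<m. (x (Suc i) - x i)\<^sup>2) / h"
      by (simp add: Q_def x_def \<beta>_def algebra_simps)
    ultimately show ?thesis using h by (simp add: x_def)
  qed
  have pt: "1 + s \<le> 8 / h * R \<omega> + (\<Sum>a\<in>B. exp s * exp (- 2 * Q a \<omega>))" for \<omega>
  proof -
    have "R \<omega> \<in> (\<lambda>a. \<Sum>j<Suc m. (W (u + real j * h) \<omega> - b a j)\<^sup>2) ` B"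
      unfolding R_def using B by (intro Min_in) auto
    then obtain a where a: "a \<in> B" "R \<omega> = (\<Sum>j<Suc m. (W (u + real j * h) \<omega> - b a j)\<^sup>2)"
      by (rule imageE)
    have "1 + (s - 2 * Q a \<omega>) \<le> exp s * exp (- 2 * Q a \<omega>)"
      using exp_ge_add_one_self[of "s - 2 * Q a \<omega>"] by (simp add: exp_add[symmetric])
    also have "\<dots> \<le> (\<Sum>a\<in>B. exp s * exp (- 2 * Q a \<omega>))"
      using a B by (intro member_le_sum) auto
    finally have "1 + s \<le> 2 * Q a \<omega> + (\<Sum>a\<in>B. exp s * exp (- 2 * Q a \<omega>))" by simp
    moreover have "2 * Q a \<omega> \<le> 8 / h * R \<omega>"
      using mult_left_mono[OF QR[of a \<omega>], of "8 / h"] a(2) h by simp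
    ultimately show ?thesis by linarith
  qed
  have R0: "0 \<le> R \<omega>" for \<omega>
    unfolding R_def using B by (subst Min_ge_iff) (auto intro!: sum_nonneg simp del: sum.lessThan_Suc)
  have "1 + ennreal s = ennreal (1 + s)"
    using True by (simp add: s_def ennreal_plus[symmetric] ennreal_1[symmetric] del: ennreal_plus ennreal_1)
  also have "\<dots> = (\<integral>\<^sup>+ \<omega>. ennreal (1 + s) \<partial>M)"
    by (simp add: emeasure_space_1)
  also have "\<dots> \<le> (\<integral>\<^sup>+ \<omega>. ennreal (8 / h) * ennreal (R \<omega>) + (\<Sum>a\<in>B. ennreal (exp s) * ennreal (exp (- 2 * Q a \<omega>))) \<partial>M)"
  proof (rule nn_integral_mono)
    fix \<omega>
    have "ennreal (1 + s) \<le> ennreal (8 / h * R \<omega> + (\<Sum>a\<in>B. exp s * exp (- 2 * Q a \<omega>)))"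
      by (rule ennreal_leI[OF pt])
    also have "\<dots> = ennreal (8 / h) * ennreal (R \<omega>) + (\<Sum>a\<in>B. ennreal (exp s) * ennreal (exp (- 2 * Q a \<omega>)))"
      using h R0 by (simp only: ennreal_plus ennreal_mult sum_nonneg sum_ennreal[symmetric]
          exp_ge_zero mult_nonneg_nonneg divide_nonneg_pos zero_le_numeral)
    finally show "ennreal (1 + s) \<le> \<dots>" .
  qed
  also have "\<dots> = ennreal (8 / h) * (\<integral>\<^sup>+ \<omega>. R \<omega> \<partial>M) + (\<Sum>a\<in>B. ennreal (exp s) * (\<integral>\<^sup>+ \<omega>. ennreal (exp (- 2 * Q a \<omega>)) \<partial>M))"
    by (simp add: nn_integral_add nn_integral_cmult nn_integral_sum)
  also have "\<dots> \<le> ennreal (8 / h) * (\<integral>\<^sup>+ \<omega>. R \<omega> \<partial>M) + (\<Sum>a\<in>B. ennreal (exp s) * ennreal ((1 / 2) ^ m))"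
    by (intro add_left_mono sum_mono mult_left_mono small) simp
  also have "(\<Sum>a\<in>B. ennreal (exp s) * ennreal ((1 / 2) ^ m)) = ennreal (real (card B) * (exp s * (1 / 2) ^ m))"
    by (simp add: ennreal_mult[symmetric] ennreal_of_nat_eq_real_of_nat)
  also have "\<dots> \<le> 1"
  proof -
    have "exp s = 2 ^ m / real n"
      using n by (simp add: s_def exp_diff exp_of_nat_mult)
    then have "exp s * (1 / 2) ^ m = 1 / real n"
      by (simp add: power_one_over)
    then show ?thesis using n B by simp
  qed
  finally have "1 + ennreal s \<le> 1 + ennreal (8 / h) * (\<integral>\<^sup>+ \<omega>. R \<omega> \<partial>M)"
    by (simp add: add.commute add_left_mono)
  then have "ennreal s \<le> ennreal (8 / h) * (\<integral>\<^sup>+ \<omega>. R \<omega> \<partial>M)"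
    by (simp add: ennreal_add_left_cancel_le)
  then have "ennreal (h / 8) * ennreal s \<le> ennreal (h / 8) * (ennreal (8 / h) * (\<integral>\<^sup>+ \<omega>. R \<omega> \<partial>M))"
    by (rule mult_left_mono) simp
  also have "\<dots> = (\<integral>\<^sup>+ \<omega>. R \<omega> \<partial>M)"
    using h by (simp add: mult.assoc[symmetric] ennreal_mult[symmetric])
  finally show ?thesis
    using h True by (simp add: R_def s_def ennreal_mult[symmetric] del: sum.lessThan_Suc)
qed

text \<open>The minimum over the code book of an integral over the offset is at least the integral of the
  minima, and for each fixed offset the random walk estimate applies.\<close>

lemma quantization_lower:
  assumes T: "0 < T" and k: "0 \<le> k"
    and \<alpha>: "\<alpha> \<subseteq> L2_space T" "finite \<alpha>" "\<alpha> \<noteq> {}" "card \<alpha> \<le> n"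
  shows "ennreal (T\<^sup>2 / (8 * (real (Suc m))\<^sup>2) * (real m * ln 2 - ln (real n))) \<le>
    (\<integral>\<^sup>+ \<omega>. ennreal (MIN a\<in>\<alpha>. (L2_norm T (\<lambda>t. shifted_process W k \<omega> t - a t))\<^sup>2) \<partial>M)"
proof -
  define h where "h = T / real (Suc m)"
  have h: "0 < h" "real (Suc m) * h = T" using T by (auto simp: h_def)
  define a0 where "a0 a t = a t * indicator {0..T} t" for a :: "real \<Rightarrow> real" and t
  have a0 [measurable]: "a0 a \<in> borel_measurable borel" if "a \<in> \<alpha>" for a
    using that \<alpha>(1) unfolding a0_def interval_lborel_measurable_iff[symmetric]
    by (auto simp: L2_space_def)
  define F where "F a u \<omega> = (\<Sum>j<Suc m. (modification (k + real j * h + u) \<omega> - a0 a (real j * h + u))\<^sup>2)"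
    for a u \<omega>
  \<comment> \<open>For each offset \<open>u\<close> a separate nearest code word is allowed.\<close>
  define G where "G u \<omega> = (MIN a\<in>\<alpha>. F a u \<omega>)" for u \<omega>
  have F[measurable]: "(\<lambda>p. F a (fst p) (snd p)) \<in> borel_measurable (lborel \<Otimes>\<^sub>M M)" if [measurable]: "a \<in> \<alpha>" for a
    unfolding F_def by measurable
  have G[measurable]: "(\<lambda>p. G (fst p) (snd p)) \<in> borel_measurable (lborel \<Otimes>\<^sub>M M)"
    unfolding G_def using \<alpha> by measurable
  interpret pair_sigma_finite lborel M ..
  have pt: "AE \<omega> in M. (\<integral>\<^sup>+ u. ennreal (G u \<omega>) * indicator {0..<h} u \<partial>lborel) \<le>
    ennreal (MIN a\<in>\<alpha>. (L2_norm T (\<lambda>t. shifted_process W k \<omega> t - a t))\<^sup>2)"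
    using AE_continuous_modification
  proof eventually_elim
    case (elim \<omega>)
    then have [measurable]: "\<omega> \<in> space M" by simp
    have "(MIN a\<in>\<alpha>. (L2_norm T (\<lambda>t. shifted_process W k \<omega> t - a t))\<^sup>2) \<in>
       (\<lambda>a. (L2_norm T (\<lambda>t. shifted_process W k \<omega> t - a t))\<^sup>2) ` \<alpha>"
      using \<alpha> by (intro Min_in) auto
    then obtain a where a: "a \<in> \<alpha>" and min: "(MIN a\<in>\<alpha>. (L2_norm T (\<lambda>t. shifted_process W k \<omega> t - a t))\<^sup>2) =
       (L2_norm T (\<lambda>t. shifted_process W k \<omega> t - a t))\<^sup>2"
      by (rule imageE)
    note [measurable] = a0[OF a]
    have "(\<integral>\<^sup>+ u. ennreal (G u \<omega>) * indicator {0..<h} u \<partial>lborel) \<le>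
        (\<integral>\<^sup>+ u. (\<Sum>j<Suc m. ennreal ((modification (k + (real j * h + u)) \<omega> - a0 a (real j * h + u))\<^sup>2) * indicator {0..<h} u) \<partial>lborel)"
    proof (rule nn_integral_mono)
      fix u
      have "G u \<omega> \<le> F a u \<omega>"
        unfolding G_def using \<alpha> a by (intro Min_le) auto
      then have "ennreal (G u \<omega>) \<le> (\<Sum>j<Suc m. ennreal ((modification (k + (real j * h + u)) \<omega> - a0 a (real j * h + u))\<^sup>2))"
        unfolding F_def by (subst sum_ennreal) (auto intro!: ennreal_leI simp: add.assoc simp del: sum.lessThan_Suc)
      then show "ennreal (G u \<omega>) * indicator {0..<h} u \<le>
        (\<Sum>j<Suc m. ennreal ((modification (k + (real j * h + u)) \<omega> - a0 a (real j * h + u))\<^sup>2) * indicator {0..<h} u)"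
        by (simp only: sum_distrib_right[symmetric] mult_right_mono zero_le)
    qed
    also have "\<dots> = (\<Sum>j<Suc m. \<integral>\<^sup>+ u. ennreal ((modification (k + (real j * h + u)) \<omega> - a0 a (real j * h + u))\<^sup>2) * indicator {0..<h} u \<partial>lborel)"
      by (rule nn_integral_sum) measurable
    also have "\<dots> = (\<integral>\<^sup>+ t. ennreal ((modification (k + t) \<omega> - a0 a t)\<^sup>2) * indicator {0..<real (Suc m) * h} t \<partial>lborel)"
      using h by (intro nn_integral_split_translates[symmetric]) auto
    also have "\<dots> \<le> (\<integral>\<^sup>+ t. ennreal ((shifted_process W k \<omega> t - a t)\<^sup>2) * indicator {0..T} t \<partial>lborel)"
      unfolding h(2) using elim k
      by (intro nn_integral_mono) (auto simp: indicator_def shifted_process_def a0_def)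
    also have "\<dots> = ennreal ((L2_norm T (\<lambda>t. shifted_process W k \<omega> t - a t))\<^sup>2)"
      using elim a \<alpha> k
      by (intro L2_norm_square[symmetric] L2_space_diff shifted_process_L2_space) auto
    finally show ?case unfolding min .
  qed
  have low: "ennreal (h / 8 * (real m * ln 2 - ln (real n))) \<le> (\<integral>\<^sup>+ \<omega>. ennreal (G u \<omega>) \<partial>M)" if u: "0 \<le> u" for u
  proof -
    have "ennreal (h / 8 * (real m * ln 2 - ln (real n))) \<le>
      (\<integral>\<^sup>+ \<omega>. ennreal (MIN a\<in>\<alpha>. \<Sum>j<Suc m. (W (k + u + real j * h) \<omega> - a0 a (real j * h + u))\<^sup>2) \<partial>M)"
      using u k h \<alpha> by (intro random_walk_quantization_lower) auto
    also have "\<dots> = (\<integral>\<^sup>+ \<omega>. ennreal (G u \<omega>) \<partial>M)"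
      by (rule nn_integral_cong_AE, use AE_continuous_modification in eventually_elim)
        (use k h u in \<open>auto simp: G_def F_def add_ac simp del: sum.lessThan_Suc intro!: arg_cong[of _ _ Min] image_cong sum.cong\<close>)
    finally show ?thesis .
  qed
  have "ennreal (T\<^sup>2 / (8 * (real (Suc m))\<^sup>2) * (real m * ln 2 - ln (real n))) =
      ennreal (h / 8 * (real m * ln 2 - ln (real n))) * ennreal h"
    using h by (subst ennreal_mult''[symmetric]) (auto simp: h_def power2_eq_square mult_ac simp del: of_nat_Suc)
  also have "\<dots> = (\<integral>\<^sup>+ u. ennreal (h / 8 * (real m * ln 2 - ln (real n))) * indicator {0..<h} u \<partial>lborel)"
    using h by (subst nn_integral_cmult_indicator) auto
  also have "\<dots> \<le> (\<integral>\<^sup>+ u. (\<integral>\<^sup>+ \<omega>. ennreal (G u \<omega>) * indicator {0..<h} u \<partial>M) \<partial>lborel)"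
    by (rule nn_integral_mono) (use low in \<open>auto simp: indicator_def\<close>)
  also have "\<dots> = (\<integral>\<^sup>+ \<omega>. (\<integral>\<^sup>+ u. ennreal (G u \<omega>) * indicator {0..<h} u \<partial>lborel) \<partial>M)"
    by (rule Fubini'[symmetric]) (unfold case_prod_beta, measurable)
  also have "\<dots> \<le> (\<integral>\<^sup>+ \<omega>. ennreal (MIN a\<in>\<alpha>. (L2_norm T (\<lambda>t. shifted_process W k \<omega> t - a t))\<^sup>2) \<partial>M)"
    by (rule nn_integral_mono_AE[OF pt])
  finally show ?thesis .
qed

lemma nn_integral_increment_square:
  assumes "0 \<le> s" "s \<le> t"
  shows "(\<integral>\<^sup>+ \<omega>. ennreal ((W t \<omega> - W s \<omega>)\<^sup>2) \<partial>M) = ennreal (t - s)"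
  using increment_moments(3,4)[OF assms] by (subst nn_integral_eq_integral) auto

text \<open>The quantization error converts an extended expectation to a real number, sending \<open>\<infinity>\<close> to \<open>0\<close>. A
  lower bound survives this conversion because the expectation is finite.\<close>

lemma expected_square_distance_finite:
  assumes k: "0 \<le> k" and T: "0 \<le> T" and a: "a \<in> L2_space T"
  shows "(\<integral>\<^sup>+ \<omega>. ennreal ((L2_norm T (\<lambda>t. shifted_process W k \<omega> t - a t))\<^sup>2) \<partial>M) < \<infinity>"
proof -
  interpret pair_sigma_finite lborel M ..
  define a0 where "a0 t = a t * indicator {0..T} t" for t
  have [measurable]: "a0 \<in> borel_measurable borel"
    using a unfolding a0_def interval_lborel_measurable_iff[symmetric] by (simp add: L2_space_def)
  have "(\<integral>\<^sup>+ \<omega>. ennreal ((L2_norm T (\<lambda>t. shifted_process W k \<omega> t - a t))\<^sup>2) \<partial>M) =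
    (\<integral>\<^sup>+ \<omega>. (\<integral>\<^sup>+ t. ennreal ((modification (k + t) \<omega> - a0 t)\<^sup>2) * indicator {0..T} t \<partial>lborel) \<partial>M)"
  proof (rule nn_integral_cong_AE, use AE_continuous_modification in eventually_elim)
    case (elim \<omega>)
    show ?case
      by (subst L2_norm_square)
        (use elim k a in \<open>auto intro!: shifted_process_L2_space L2_space_diff\<close>,
         use elim k in \<open>auto intro!: nn_integral_cong simp: indicator_def shifted_process_def a0_def\<close>)
  qed
  also have "\<dots> = (\<integral>\<^sup>+ t. (\<integral>\<^sup>+ \<omega>. ennreal ((modification (k + t) \<omega> - a0 t)\<^sup>2) * indicator {0..T} t \<partial>M) \<partial>lborel)"
    by (rule Fubini') (unfold case_prod_beta, measurable)
  also have "\<dots> \<le> (\<integral>\<^sup>+ t. ennreal (2 * (k + T)) * indicator {0..T} t + 2 * (ennreal ((a0 t)\<^sup>2) * indicator {0..T} t) \<partial>lborel)"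
  proof (rule nn_integral_mono)
    fix t
    show "(\<integral>\<^sup>+ \<omega>. ennreal ((modification (k + t) \<omega> - a0 t)\<^sup>2) * indicator {0..T} t \<partial>M) \<le>
      ennreal (2 * (k + T)) * indicator {0..T} t + 2 * (ennreal ((a0 t)\<^sup>2) * indicator {0..T} t)"
    proof (cases "t \<in> {0..T}")
      case True
      have [measurable]: "W (k + t) \<in> borel_measurable M" "W 0 \<in> borel_measurable M"
        using True k by (auto intro!: random_variable_W)
      have "(\<integral>\<^sup>+ \<omega>. ennreal ((modification (k + t) \<omega> - a0 t)\<^sup>2) \<partial>M) \<le>
         (\<integral>\<^sup>+ \<omega>. 2 * ennreal ((W (k + t) \<omega> - W 0 \<omega>)\<^sup>2) + ennreal (2 * (a0 t)\<^sup>2) \<partial>M)"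
      proof (rule nn_integral_mono_AE, use AE_continuous_modification start_zero in eventually_elim)
        case (elim \<omega>)
        have "(x - y)\<^sup>2 \<le> 2 * x\<^sup>2 + 2 * y\<^sup>2" for x y :: real
          using zero_le_power2[of "x + y"] by (simp add: power2_eq_square algebra_simps)
        from ennreal_leI[OF this[of "W (k + t) \<omega>" "a0 t"]] show ?case
          using elim True k by (simp add: ennreal_mult)
      qed
      also have "\<dots> = 2 * ennreal (k + t) + ennreal (2 * (a0 t)\<^sup>2)"
        using True k
        by (simp add: nn_integral_add nn_integral_cmult nn_integral_increment_square emeasure_space_1 del: ennreal_plus)
      also have "\<dots> \<le> ennreal (2 * (k + T)) + 2 * ennreal ((a0 t)\<^sup>2)"
      proof (rule add_mono)
        have "2 * ennreal (k + t) = ennreal (2 * (k + t))"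
          using True k by (subst ennreal_mult) auto
        then show "2 * ennreal (k + t) \<le> ennreal (2 * (k + T))"
          using True by (simp add: ennreal_leI del: ennreal_plus)
      qed (simp add: ennreal_mult)
      finally show ?thesis using True by simp
    qed simp
  qed
  also have "\<dots> = ennreal (2 * (k + T)) * ennreal T + 2 * (\<integral>\<^sup>+ t. ennreal ((a0 t)\<^sup>2) * indicator {0..T} t \<partial>lborel)"
    using T by (simp add: nn_integral_add nn_integral_cmult nn_integral_cmult_indicator)
  also have "(\<integral>\<^sup>+ t. ennreal ((a0 t)\<^sup>2) * indicator {0..T} t \<partial>lborel) = ennreal ((L2_norm T a)\<^sup>2)"
    unfolding L2_norm_square[OF a]
    by (rule nn_integral_cong) (auto simp: a0_def indicator_def)
  also have "ennreal (2 * (k + T)) * ennreal T + 2 * ennreal ((L2_norm T a)\<^sup>2) < \<infinity>"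
    by (auto simp: ennreal_mult_less_top less_top[symmetric] ennreal_mult_eq_top_iff simp del: ennreal_plus)
  finally show ?thesis .
qed

end

lemma powr_neg_half: "0 < L \<Longrightarrow> L powr (- 1 / 2) = 1 / sqrt L" for L :: real
  using powr_minus_divide[of L "1 / 2"] powr_half_sqrt[of L] by simp

context wiener_process begin

text \<open>The preceding bound is maximal, up to constants, when \<open>m\<close> is a constant multiple of \<open>ln n\<close>.\<close>

lemma quantization_error_lower:
  assumes T: "0 < T" and k: "0 \<le> k" and n: "3 \<le> n"
  shows "sqrt (T\<^sup>2 / 288) * ln (real n) powr (- 1 / 2) \<le> quantization_error T M (shifted_process W k) n"
proof -
  define L where "L = ln (real n)"
  have "exp 1 \<le> real n" using n exp_le by linarith
  then have L: "1 \<le> L" using n by (simp add: L_def ln_ge_iff)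
  \<comment> \<open>Since \<open>ln 2 \<ge> 1 / 2\<close>, this gives \<open>m ln 2 - ln n \<ge> ln n\<close>.\<close>
  define m where "m = nat \<lceil>4 * L\<rceil>"
  have m: "4 * L \<le> real m" "real (Suc m) \<le> 6 * L"
    using L by (auto simp: m_def) linarith+
  have ln2: "1 / 2 \<le> ln (2 :: real)"
    using ln2_ge_two_thirds by linarith
  have "L \<le> real m * ln 2 - L"
    using mult_mono[OF m(1) ln2] L by simp
  moreover have "T\<^sup>2 / (8 * (6 * L)\<^sup>2) \<le> T\<^sup>2 / (8 * (real (Suc m))\<^sup>2)"
    using m L by (intro divide_left_mono mult_left_mono power_mono mult_pos_pos) auto
  ultimately have "T\<^sup>2 / (8 * (6 * L)\<^sup>2) * L \<le> T\<^sup>2 / (8 * (real (Suc m))\<^sup>2) * (real m * ln 2 - L)"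
    using L by (intro mult_mono) auto
  moreover have "T\<^sup>2 / (8 * (6 * L)\<^sup>2) * L = T\<^sup>2 / 288 / L"
    using L by (simp add: power2_eq_square field_simps)
  ultimately have c: "T\<^sup>2 / 288 / L \<le> T\<^sup>2 / (8 * (real (Suc m))\<^sup>2) * (real m * ln 2 - L)" by simp
  have e: "sqrt (T\<^sup>2 / 288) * ln (real n) powr (- 1 / 2) = sqrt (T\<^sup>2 / 288 / L)"
    using L powr_neg_half[of L] unfolding L_def[symmetric] by (simp only: real_sqrt_divide) simp
  show ?thesis
    unfolding quantization_error_def e
  proof (rule cINF_greatest)
    have "{\<lambda>t. 0} \<in> {\<alpha>. \<alpha> \<subseteq> L2_space T \<and> finite \<alpha> \<and> 1 \<le> card \<alpha> \<and> card \<alpha> \<le> n}"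
      using n L2_space_continuous[of T "\<lambda>t. 0"] by auto
    then show "{\<alpha>. \<alpha> \<subseteq> L2_space T \<and> finite \<alpha> \<and> 1 \<le> card \<alpha> \<and> card \<alpha> \<le> n} \<noteq> {}" by blast
  next
    fix \<alpha> assume "\<alpha> \<in> {\<alpha>. \<alpha> \<subseteq> L2_space T \<and> finite \<alpha> \<and> 1 \<le> card \<alpha> \<and> card \<alpha> \<le> n}"
    then have \<alpha>: "\<alpha> \<subseteq> L2_space T" "finite \<alpha>" "\<alpha> \<noteq> {}" "card \<alpha> \<le> n" by auto
    define J where "J = (\<integral>\<^sup>+ \<omega>. ennreal (MIN a\<in>\<alpha>. (L2_norm T (\<lambda>t. shifted_process W k \<omega> t - a t))\<^sup>2) \<partial>M)"
    obtain a where a: "a \<in> \<alpha>" using \<alpha> by blast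
    have "J \<le> (\<integral>\<^sup>+ \<omega>. ennreal ((L2_norm T (\<lambda>t. shifted_process W k \<omega> t - a t))\<^sup>2) \<partial>M)"
      unfolding J_def using \<alpha> a by (intro nn_integral_mono ennreal_leI Min_le) auto
    also have "\<dots> < \<infinity>"
      using a \<alpha> T k by (intro expected_square_distance_finite) auto
    finally have fin: "J < top" by simp
    have "ennreal (T\<^sup>2 / 288 / L) \<le> J"
      unfolding J_def L_def
      by (rule order_trans[OF ennreal_leI[OF c[unfolded L_def]] quantization_lower[OF T k \<alpha>]])
    then have "T\<^sup>2 / 288 / L \<le> enn2real J"
      using L enn2real_mono[OF _ fin] by fastforce
    then show "sqrt (T\<^sup>2 / 288 / L) \<le>
      sqrt (enn2real (\<integral>\<^sup>+ \<omega>. ennreal (MIN a\<in>\<alpha>. (L2_norm T (\<lambda>t. shifted_process W k \<omega> t - a t))\<^sup>2) \<partial>M))"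
      by (simp add: J_def)
  qed
qed

end

section \<open>Codebooks of integer-valued lattice paths\<close>

text \<open>The increments of integer-valued paths with \<open>m\<close> steps starting at \<open>0\<close>. The bound \<open>4 m\<close> leaves \<open>3 m\<close> for
  the variation of the path to be approximated and \<open>m\<close> for the rounding of its values.\<close>

definition bounded_paths :: "nat \<Rightarrow> (nat \<Rightarrow> int) set" where
  "bounded_paths m = {d \<in> {..<m} \<rightarrow>\<^sub>E {- int (4 * m)..int (4 * m)}. (\<Sum>i<m. \<bar>d i\<bar>) \<le> int (4 * m)}"

lemma sum_half_powers_le: "(\<Sum>j = - int N..int N. (1 / 2 :: real) ^ nat \<bar>j\<bar>) \<le> 3"
proof -
  have "(\<Sum>j = - int N..int N. (1 / 2 :: real) ^ nat \<bar>j\<bar>) = 3 - 2 * (1 / 2) ^ N"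
  proof (induction N)
    case (Suc N)
    have "{- int (Suc N)..int (Suc N)} = insert (int (Suc N)) (insert (- int (Suc N)) {- int N..int N})"
      by auto
    moreover have "nat \<bar>- int (Suc N)\<bar> = Suc N" "nat \<bar>int (Suc N)\<bar> = Suc N" by auto
    ultimately show ?case using Suc by (simp del: of_nat_Suc)
  qed simp
  then show ?thesis by simp
qed

lemma finite_bounded_paths: "finite (bounded_paths m)"
  unfolding bounded_paths_def by (rule finite_subset[of _ "{..<m} \<rightarrow>\<^sub>E {- int (4 * m)..int (4 * m)}"]) (auto intro: finite_PiE)

text \<open>Weighting a path by \<open>2\<close> to the power of minus its variation makes the total weight of all paths a
  product of geometric sums, at most \<open>3\<^sup>m\<close>, while each counted path has weight at least \<open>2\<^sup>-\<^sup>4\<^sup>m\<close>.\<close>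

lemma card_bounded_paths: "card (bounded_paths m) \<le> 48 ^ m"
proof -
  define P where "P = ({..<m} \<rightarrow>\<^sub>E {- int (4 * m)..int (4 * m)})"
  have P: "finite P" "bounded_paths m \<subseteq> P"
    by (auto simp: P_def bounded_paths_def intro: finite_PiE)
  have one: "1 \<le> 2 ^ (4 * m) * (\<Prod>i<m. (1 / 2 :: real) ^ nat \<bar>d i\<bar>)" if "d \<in> bounded_paths m" for d
  proof -
    have "int (\<Sum>i<m. nat \<bar>d i\<bar>) \<le> int (4 * m)"
      using that by (simp add: bounded_paths_def)
    then have "(\<Sum>i<m. nat \<bar>d i\<bar>) \<le> 4 * m" by linarith
    then have "(1 / 2 :: real) ^ (4 * m) \<le> (1 / 2) ^ (\<Sum>i<m. nat \<bar>d i\<bar>)"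
      by (intro power_decreasing) auto
    then have "2 ^ (4 * m) * (1 / 2 :: real) ^ (4 * m) \<le> 2 ^ (4 * m) * (\<Prod>i<m. (1 / 2) ^ nat \<bar>d i\<bar>)"
      unfolding power_sum by (rule mult_left_mono) simp
    then show ?thesis by (simp add: power_mult_distrib[symmetric])
  qed
  have "real (card (bounded_paths m)) \<le> (\<Sum>d\<in>bounded_paths m. 2 ^ (4 * m) * (\<Prod>i<m. (1 / 2) ^ nat \<bar>d i\<bar>))"
    using sum_mono[OF one] by simp
  also have "\<dots> \<le> (\<Sum>d\<in>P. 2 ^ (4 * m) * (\<Prod>i<m. (1 / 2) ^ nat \<bar>d i\<bar>))"
    using P by (intro sum_mono2) (auto intro!: mult_nonneg_nonneg prod_nonneg)
  also have "\<dots> = 2 ^ (4 * m) * (\<Prod>i<m. \<Sum>j = - int (4 * m)..int (4 * m). (1 / 2) ^ nat \<bar>j\<bar>)"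
    unfolding P_def sum_distrib_left[symmetric] by (subst prod_sum_PiE) auto
  also have "\<dots> \<le> 2 ^ (4 * m) * (\<Prod>i<m. 3)"
    by (intro mult_left_mono prod_mono conjI sum_half_powers_le sum_nonneg) auto
  also have "\<dots> = 48 ^ m"
    by (simp add: power_mult power_mult_distrib[symmetric])
  finally show ?thesis
    by (metis (mono_tags) of_nat_le_iff of_nat_numeral of_nat_power)
qed

lemma bounded_paths_partial_sum:
  assumes "d \<in> bounded_paths m" "j \<le> m"
  shows "\<bar>\<Sum>i<j. d i\<bar> \<le> int (4 * m)"
proof -
  have "\<bar>\<Sum>i<j. d i\<bar> \<le> (\<Sum>i<j. \<bar>d i\<bar>)" by (rule sum_abs)
  also have "\<dots> \<le> (\<Sum>i<m. \<bar>d i\<bar>)" using assms by (intro sum_mono2) auto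
  also have "\<dots> \<le> int (4 * m)" using assms by (simp add: bounded_paths_def)
  finally show ?thesis .
qed

text \<open>If the variation \<open>V\<close> of \<open>S\<close> is at most \<open>3 m\<close>, rounding gives an admissible path. Otherwise the zero
  path is used, and its error is at most \<open>V\<^sup>2 \<le> 2 e\<^sup>V \<le> 2 e\<^sup>V e\<^sup>V\<^sup>-\<^sup>3\<^sup>m\<close>. For the Wiener process the
  exponential on the right has bounded expectation, so that in the mean large variation adds only a
  bounded error.\<close>

lemma bounded_paths_approximation:
  fixes S :: "nat \<Rightarrow> real" and m :: nat
  assumes S0: "S 0 = 0"
  defines "V \<equiv> \<Sum>i<m. \<bar>S (Suc i) - S i\<bar>"
  shows "\<exists>d\<in>bounded_paths m. \<forall>j\<le>m. (S j - (\<Sum>i<j. real_of_int (d i)))\<^sup>2 \<le> 1 + 2 * exp (2 * V - 3 * real m)"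
proof (cases "V \<le> 3 * real m")
  case True
  define d where "d i = (if i < m then round (S (Suc i)) - round (S i) else undefined)" for i
  have d: "\<bar>d i\<bar> \<le> \<bar>S (Suc i) - S i\<bar> + 1" if "i < m" for i
    using that of_int_round_abs_le[of "S (Suc i)"] of_int_round_abs_le[of "S i"]
    by (simp add: d_def abs_if split: if_splits)
  have "real_of_int (\<Sum>i<m. \<bar>d i\<bar>) \<le> (\<Sum>i<m. \<bar>S (Suc i) - S i\<bar> + 1)"
    unfolding of_int_sum using d by (intro sum_mono) auto
  also have "\<dots> \<le> real_of_int (int (4 * m))"
    using True by (simp add: sum.distrib V_def)
  finally have sum: "(\<Sum>i<m. \<bar>d i\<bar>) \<le> int (4 * m)" by linarith
  have "\<bar>d i\<bar> \<le> int (4 * m)" if "i < m" for i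
    using sum member_le_sum[of i "{..<m}" "\<lambda>i. \<bar>d i\<bar>"] that by simp
  then have "d \<in> bounded_paths m"
    using sum unfolding bounded_paths_def
    by (auto simp: abs_le_iff PiE_iff extensional_def minus_le_iff) (simp add: d_def)
  moreover have "(S j - (\<Sum>i<j. real_of_int (d i)))\<^sup>2 \<le> 1 + 2 * exp (2 * V - 3 * real m)" if "j \<le> m" for j
  proof -
    have "(\<Sum>i<j. d i) = (\<Sum>i<j. round (S (Suc i)) - round (S i))"
      using that by (intro sum.cong) (auto simp: d_def)
    also have "\<dots> = round (S j)"
      using S0 sum_lessThan_telescope[of "\<lambda>i. round (S i)" j] by simp
    finally have "(\<Sum>i<j. real_of_int (d i)) = real_of_int (round (S j))"
      by (simp only: of_int_sum[symmetric])
    then have "\<bar>S j - (\<Sum>i<j. real_of_int (d i))\<bar> \<le> 1"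
      using of_int_round_abs_le[of "S j"] by (simp add: abs_if split: if_splits)
    then have "(S j - (\<Sum>i<j. real_of_int (d i)))\<^sup>2 \<le> 1"
      by (simp add: abs_square_le_1)
    then show ?thesis by (smt (verit) exp_ge_zero)
  qed
  ultimately show ?thesis by blast
next
  case False
  define d where "d i = (if i < m then 0 else undefined :: int)" for i
  have "d \<in> bounded_paths m"
    unfolding bounded_paths_def by (auto simp: d_def split: if_splits)
  moreover have "(S j - (\<Sum>i<j. real_of_int (d i)))\<^sup>2 \<le> 1 + 2 * exp (2 * V - 3 * real m)" if "j \<le> m" for j
  proof -
    have zero: "(\<Sum>i<j. real_of_int (d i)) = 0"
      using that by (intro sum.neutral) (auto simp: d_def)
    have "S j = (\<Sum>i<j. S (Suc i) - S i)"
      using S0 by (simp add: sum_lessThan_telescope)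
    then have "\<bar>S j\<bar> \<le> (\<Sum>i<j. \<bar>S (Suc i) - S i\<bar>)"
      by (simp only: sum_abs)
    then have "\<bar>S j\<bar> \<le> V"
      using sum_mono2[of "{..<m}" "{..<j}" "\<lambda>i. \<bar>S (Suc i) - S i\<bar>"] that by (simp add: V_def)
    then have "(S j)\<^sup>2 \<le> V\<^sup>2"
      using power_mono[of "\<bar>S j\<bar>" V 2] by simp
    also have "V\<^sup>2 \<le> 2 * exp V"
      using exp_lower_Taylor_quadratic[of V] False by (smt (verit) field_sum_of_halves of_nat_0_le_iff)
    also have "\<dots> \<le> 2 * exp (2 * V - 3 * real m)"
      using False by simp
    finally show ?thesis by (simp add: zero)
  qed
  ultimately show ?thesis by blast
qed

text \<open>The steps are those of the path with increments \<open>d\<close>, in units of \<open>sqrt h\<close>, at the multiples of \<open>h\<close> on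
  the time axis of the Wiener process, which runs ahead of that of the shifted process by \<open>k\<close>.\<close>

definition step_path :: "real \<Rightarrow> real \<Rightarrow> (nat \<Rightarrow> int) \<Rightarrow> real \<Rightarrow> real" where
  "step_path h k d t = sqrt h * (\<Sum>i<nat \<lfloor>(k + t) / h\<rfloor>. real_of_int (d i))"

lemma floor_grid:
  assumes "0 < h" "0 \<le> x" "x \<le> real m * h"
  shows "nat \<lfloor>x / h\<rfloor> \<le> m" "real (nat \<lfloor>x / h\<rfloor>) * h \<le> x" "x - real (nat \<lfloor>x / h\<rfloor>) * h \<le> h"
proof -
  have "x / h \<le> real m" using assms by (simp add: divide_le_eq)
  then show "nat \<lfloor>x / h\<rfloor> \<le> m" by linarith
  have "0 \<le> x / h" using assms by simp
  then have "real (nat \<lfloor>x / h\<rfloor>) \<le> x / h" "x / h \<le> real (nat \<lfloor>x / h\<rfloor>) + 1" by linarith+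
  then show "real (nat \<lfloor>x / h\<rfloor>) * h \<le> x" "x - real (nat \<lfloor>x / h\<rfloor>) * h \<le> h"
    using assms by (auto simp: le_divide_eq divide_le_eq algebra_simps)
qed

lemma step_path_L2_space:
  assumes d: "d \<in> bounded_paths m" and h: "0 < h" "k + T = real m * h" "0 \<le> k"
  shows "step_path h k d \<in> L2_space T"
proof (rule L2_space_bounded)
  show "step_path h k d \<in> borel_measurable (interval_lborel T)"
  proof (rule interval_lborel_measurableI)
    show "step_path h k d \<in> borel_measurable borel"
      unfolding step_path_def
      by (rule measurable_compose[of "\<lambda>t. nat \<lfloor>(k + t) / h\<rfloor>" borel "count_space UNIV"
          "\<lambda>n. sqrt h * (\<Sum>i<n. real_of_int (d i))"]) measurable
  qed
  fix t assume t: "t \<in> {0..T}"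
  have "nat \<lfloor>(k + t) / h\<rfloor> \<le> m" using t h by (intro floor_grid) auto
  from bounded_paths_partial_sum[OF d this]
  have "\<bar>\<Sum>i<nat \<lfloor>(k + t) / h\<rfloor>. real_of_int (d i)\<bar> \<le> real (4 * m)"
    by (simp only: of_int_sum[symmetric] of_int_abs[symmetric])
  then show "\<bar>step_path h k d t\<bar> \<le> sqrt h * real (4 * m)"
    using h by (simp add: step_path_def abs_mult mult_left_mono)
qed

section \<open>Upper bound for the quantization error\<close>

context wiener_process begin

text \<open>For the normalised increment \<open>x\<close>, bound \<open>exp (2 \<bar>x\<bar>)\<close> by \<open>exp (2 x) + exp (- 2 x)\<close> and complete the
  square; multiplied by the Gaussian density, each summand becomes \<open>exp 2\<close> times a Gaussian density
  with shifted mean.\<close>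

lemma increment_exponential_moment:
  assumes "0 \<le> s" "s < t"
  shows "(\<integral>\<^sup>+ \<omega>. ennreal (exp (2 * \<bar>W t \<omega> - W s \<omega>\<bar> / sqrt (t - s))) \<partial>M) \<le> ennreal (2 * exp 2)"
proof -
  define \<sigma> where "\<sigma> = sqrt (t - s)"
  have s: "\<sigma> > 0" using assms by (auto simp: \<sigma>_def)
  have "(\<integral>\<^sup>+ \<omega>. ennreal (exp (2 * \<bar>W t \<omega> - W s \<omega>\<bar> / \<sigma>)) \<partial>M) =
      (\<integral>\<^sup>+ x. ennreal (normal_density 0 \<sigma> x) * ennreal (exp (2 * \<bar>x\<bar> / \<sigma>)) \<partial>lborel)"
    unfolding \<sigma>_def
    by (rule distributed_nn_integral[OF normal_increments[OF assms], symmetric]) simp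
  also have "\<dots> \<le> (\<integral>\<^sup>+ x. ennreal (exp 2) * (ennreal (normal_density (2 * \<sigma>) \<sigma> x) + ennreal (normal_density (- 2 * \<sigma>) \<sigma> x)) \<partial>lborel)"
  proof (rule nn_integral_mono)
    fix x
    have q: "normal_density 0 \<sigma> x * exp (2 * c * x / \<sigma>) = exp 2 * normal_density (2 * c * \<sigma>) \<sigma> x"
      if "c\<^sup>2 = 1" for c
    proof -
      have "- (x\<^sup>2 / (2 * \<sigma>\<^sup>2)) + 2 * c * x / \<sigma> = 2 * c\<^sup>2 - (x - 2 * c * \<sigma>)\<^sup>2 / (2 * \<sigma>\<^sup>2)"
        using s by (simp add: field_simps power2_eq_square)
      then show ?thesis
        unfolding normal_density_def using that
        by (simp add: exp_add[symmetric] field_simps)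
    qed
    have "normal_density 0 \<sigma> x * exp (2 * \<bar>x\<bar> / \<sigma>) \<le>
       normal_density 0 \<sigma> x * (exp (2 * 1 * x / \<sigma>) + exp (2 * (-1) * x / \<sigma>))"
      by (intro mult_left_mono) (auto simp: abs_if)
    also have "\<dots> = exp 2 * (normal_density (2 * \<sigma>) \<sigma> x + normal_density (- 2 * \<sigma>) \<sigma> x)"
      using q[of 1] q[of "-1"] by (simp add: distrib_left)
    finally show "ennreal (normal_density 0 \<sigma> x) * ennreal (exp (2 * \<bar>x\<bar> / \<sigma>)) \<le>
       ennreal (exp 2) * (ennreal (normal_density (2 * \<sigma>) \<sigma> x) + ennreal (normal_density (- 2 * \<sigma>) \<sigma> x))"
      by (subst ennreal_plus[symmetric], simp, simp, subst (1 2) ennreal_mult[symmetric])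
        (auto intro!: ennreal_leI)
  qed
  also have "\<dots> = ennreal (exp 2) * (1 + 1)"
    using s by (subst nn_integral_cmult) (auto simp: nn_integral_eq_integral nn_integral_add)
  also have "\<dots> = ennreal (2 * exp 2)"
    by (simp add: ennreal_mult mult.commute)
  finally show ?thesis by (simp add: \<sigma>_def)
qed

text \<open>By independence this is at most \<open>(2 e\<^sup>2 e\<^sup>-\<^sup>3)\<^sup>m\<close>, and \<open>2 \<le> e\<close>.\<close>

lemma exponential_variation_moment:
  assumes h: "0 < h"
  shows "(\<integral>\<^sup>+ \<omega>. ennreal (exp (2 * (\<Sum>i<m. \<bar>W (real (Suc i) * h) \<omega> - W (real i * h) \<omega>\<bar> / sqrt h) - 3 * real m)) \<partial>M) \<le> 1"
proof -
  define \<tau> where "\<tau> i = real i * h" for i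
  have [simp]: "0 \<le> \<tau> i" for i using assms by (simp add: \<tau>_def)
  have [simp]: "\<tau> (Suc i) - \<tau> i = h" for i by (simp add: \<tau>_def algebra_simps)
  have less: "\<tau> i < \<tau> (Suc i)" for i using h by (simp add: \<tau>_def)
  have ind: "indep_vars (\<lambda>_. borel) (\<lambda>i \<omega>. W (\<tau> (Suc i)) \<omega> - W (\<tau> i) \<omega>) {..<m}"
    using less by (intro indep_increments) (auto intro: less_imp_le)
  define E where "E i \<omega> = ennreal (exp (2 * \<bar>W (\<tau> (Suc i)) \<omega> - W (\<tau> i) \<omega>\<bar> / sqrt h - 3))" for i \<omega>
  have indE: "indep_vars (\<lambda>_. borel) E {..<m}"
    unfolding E_def by (rule indep_vars_compose2[OF ind, where Y = "\<lambda>i x. ennreal (exp (2 * \<bar>x\<bar> / sqrt h - 3))"]) simp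
  have "(\<integral>\<^sup>+ \<omega>. ennreal (exp (2 * (\<Sum>i<m. \<bar>W (\<tau> (Suc i)) \<omega> - W (\<tau> i) \<omega>\<bar> / sqrt h) - 3 * real m)) \<partial>M)
     = (\<integral>\<^sup>+ \<omega>. (\<Prod>i<m. E i \<omega>) \<partial>M)"
    unfolding E_def
    by (simp add: prod_ennreal exp_sum[symmetric] sum_distrib_left sum_divide_distrib sum_subtractf mult.commute)
  also have "\<dots> = (\<Prod>i<m. \<integral>\<^sup>+ \<omega>. E i \<omega> \<partial>M)"
    by (rule indep_vars_nn_integral[OF _ indE]) auto
  also have "\<dots> \<le> (\<Prod>i<m. 1)"
  proof (rule prod_mono_ennreal)
    fix i
    have [measurable]: "W (\<tau> i) \<in> borel_measurable M" for i by (rule random_variable_W) simp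
    have "(\<integral>\<^sup>+ \<omega>. E i \<omega> \<partial>M) = (\<integral>\<^sup>+ \<omega>. ennreal (exp (- 3)) * ennreal (exp (2 * \<bar>W (\<tau> (Suc i)) \<omega> - W (\<tau> i) \<omega>\<bar> / sqrt h)) \<partial>M)"
      unfolding E_def by (simp add: ennreal_mult[symmetric] exp_add[symmetric])
    also have "\<dots> = ennreal (exp (- 3)) * (\<integral>\<^sup>+ \<omega>. ennreal (exp (2 * \<bar>W (\<tau> (Suc i)) \<omega> - W (\<tau> i) \<omega>\<bar> / sqrt h)) \<partial>M)"
      by (rule nn_integral_cmult) measurable
    also have "\<dots> \<le> ennreal (exp (- 3)) * ennreal (2 * exp 2)"
      using increment_exponential_moment[of "\<tau> i" "\<tau> (Suc i)"] less by (intro mult_left_mono) auto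
    also have "\<dots> = ennreal (exp (- 3) * (2 * exp 2))"
      by (simp add: ennreal_mult)
    also have "exp (- 3) * (2 * exp 2) = 2 * exp (- 1 :: real)"
      by (simp add: exp_add[symmetric])
    also have "2 * exp (- 1 :: real) \<le> 1"
      using exp_ge_add_one_self[of 1] by (simp add: exp_minus field_simps)
    finally show "(\<integral>\<^sup>+ \<omega>. E i \<omega> \<partial>M) \<le> 1" by (simp add: ennreal_leI)
  qed
  finally show ?thesis by (simp add: \<tau>_def)
qed

text \<open>The squared error is at most twice the sum of two parts of order \<open>h\<close>: the oscillation of the process
  within a grid cell, and the error of the lattice path at the grid point to the left.\<close>

lemma quantization_upper:
  assumes T: "0 < T" and k: "0 \<le> k" and m: "1 \<le> m"
  shows "\<exists>\<alpha>. \<alpha> \<subseteq> L2_space T \<and> finite \<alpha> \<and> \<alpha> \<noteq> {} \<and> card \<alpha> \<le> 48 ^ m \<and>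
    (\<integral>\<^sup>+ \<omega>. ennreal (MIN a\<in>\<alpha>. (L2_norm T (\<lambda>t. shifted_process W k \<omega> t - a t))\<^sup>2) \<partial>M)
      \<le> ennreal (8 * T * (k + T) / real m)"
proof -
  define h where "h = (k + T) / real m"
  have h: "0 < h" "k + T = real m * h" using T k m by (auto simp: h_def)
  define \<alpha> where "\<alpha> = step_path h k ` bounded_paths m"
  have "(\<lambda>i. if i < m then 0 else undefined) \<in> bounded_paths m"
    unfolding bounded_paths_def by (auto split: if_splits)
  then have \<alpha>: "\<alpha> \<subseteq> L2_space T" "finite \<alpha>" "\<alpha> \<noteq> {}" "card \<alpha> \<le> 48 ^ m"
    using step_path_L2_space[OF _ h k] finite_bounded_paths card_image_le[OF finite_bounded_paths, of "step_path h k" m]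
      card_bounded_paths[of m]
    by (auto simp: \<alpha>_def intro: le_trans)
  \<comment> \<open>The last grid point before \<open>k + t\<close>.\<close>
  define g where "g t = real (nat \<lfloor>(k + t) / h\<rfloor>) * h" for t
  have g: "0 \<le> g t" "g t \<le> k + t" "k + t - g t \<le> h" "nat \<lfloor>(k + t) / h\<rfloor> \<le> m" if "t \<in> {0..T}" for t
    using that h k floor_grid[of h "k + t" m] by (auto simp: g_def)
  have [measurable]: "(\<lambda>p. modification (g (fst p)) (snd p)) \<in> borel_measurable (lborel \<Otimes>\<^sub>M M)"
    using measurable_compose[OF _ modification_measurable, of "\<lambda>p. (g (fst p), snd p)" "lborel \<Otimes>\<^sub>M M"]
    by (simp add: g_def)
  define Y where "Y \<omega> = exp (2 * (\<Sum>i<m. \<bar>W (real (Suc i) * h) \<omega> - W (real i * h) \<omega>\<bar> / sqrt h) - 3 * real m)" for \<omega>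
  have [measurable]: "W (real i * h) \<in> borel_measurable M" for i
    using h by (intro random_variable_W) simp
  have [measurable]: "Y \<in> borel_measurable M"
    unfolding Y_def by measurable
  have EY: "(\<integral>\<^sup>+ \<omega>. ennreal (Y \<omega>) \<partial>M) \<le> 1"
    unfolding Y_def by (rule exponential_variation_moment[OF h(1)])
  interpret pair_sigma_finite lborel M ..
  define I where "I \<omega> = (\<integral>\<^sup>+ t. ennreal (2 * (modification (k + t) \<omega> - modification (g t) \<omega>)\<^sup>2) * indicator {0..T} t \<partial>lborel)" for \<omega>
  have "(\<integral>\<^sup>+ \<omega>. ennreal (MIN a\<in>\<alpha>. (L2_norm T (\<lambda>t. shifted_process W k \<omega> t - a t))\<^sup>2) \<partial>M) \<le>
    (\<integral>\<^sup>+ \<omega>. I \<omega> + ennreal (2 * h * T) * (1 + 2 * ennreal (Y \<omega>)) \<partial>M)"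
  proof (rule nn_integral_mono_AE, use AE_continuous_modification start_zero in eventually_elim)
    case (elim \<omega>)
    then have [measurable]: "\<omega> \<in> space M" by simp
    have [measurable]: "(\<lambda>t. modification (g t) \<omega>) \<in> borel_measurable borel"
      using measurable_compose[OF _ modification_section_measurable, of g borel \<omega>] elim
      by (simp add: g_def)
    define S where "S i = W (real i * h) \<omega> / sqrt h" for i
    have "S 0 = 0" using elim by (simp add: S_def)
    from bounded_paths_approximation[where S = S and m = m, OF this] obtain d where d: "d \<in> bounded_paths m"
      and app: "\<And>j. j \<le> m \<Longrightarrow> (S j - (\<Sum>i<j. real_of_int (d i)))\<^sup>2 \<le> 1 + 2 * Y \<omega>"
      using h by (auto simp: Y_def S_def diff_divide_distrib[symmetric] abs_divide)
    have a: "step_path h k d \<in> \<alpha>" using d by (simp add: \<alpha>_def)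
    have pt: "(shifted_process W k \<omega> t - step_path h k d t)\<^sup>2 \<le>
        2 * (modification (k + t) \<omega> - modification (g t) \<omega>)\<^sup>2 + 2 * h * (1 + 2 * Y \<omega>)" if t: "t \<in> {0..T}" for t
    proof -
      define j where "j = nat \<lfloor>(k + t) / h\<rfloor>"
      have e: "W (g t) \<omega> - step_path h k d t = sqrt h * (S j - (\<Sum>i<j. real_of_int (d i)))"
        using h by (simp add: S_def step_path_def g_def j_def right_diff_distrib)
      have "(W (g t) \<omega> - step_path h k d t)\<^sup>2 \<le> h * (1 + 2 * Y \<omega>)"
        unfolding e power_mult_distrib using app[of j] g[OF t] h by (simp add: j_def mult_left_mono)
      moreover have "(x - z)\<^sup>2 \<le> 2 * (x - y)\<^sup>2 + 2 * (y - z)\<^sup>2" for x y z :: real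
        using zero_le_power2[of "x - 2 * y + z"] by (simp add: power2_eq_square algebra_simps)
      from this[of "W (k + t) \<omega>" "step_path h k d t" "W (g t) \<omega>"]
      have "(shifted_process W k \<omega> t - step_path h k d t)\<^sup>2 \<le>
        2 * (W (k + t) \<omega> - W (g t) \<omega>)\<^sup>2 + 2 * (W (g t) \<omega> - step_path h k d t)\<^sup>2"
        by (simp add: shifted_process_def)
      ultimately show ?thesis using elim g[OF t] t k by simp
    qed
    have "ennreal (MIN a\<in>\<alpha>. (L2_norm T (\<lambda>t. shifted_process W k \<omega> t - a t))\<^sup>2) \<le>
      ennreal ((L2_norm T (\<lambda>t. shifted_process W k \<omega> t - step_path h k d t))\<^sup>2)"
      using \<alpha> a by (intro ennreal_leI Min_le) auto
    also have "\<dots> = (\<integral>\<^sup>+ t. ennreal ((shifted_process W k \<omega> t - step_path h k d t)\<^sup>2) * indicator {0..T} t \<partial>lborel)"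
      using elim a \<alpha> k by (intro L2_norm_square L2_space_diff shifted_process_L2_space) auto
    also have "\<dots> \<le> (\<integral>\<^sup>+ t. ennreal (2 * (modification (k + t) \<omega> - modification (g t) \<omega>)\<^sup>2) * indicator {0..T} t
        + ennreal (2 * h * (1 + 2 * Y \<omega>)) * indicator {0..T} t \<partial>lborel)"
    proof (rule nn_integral_mono)
      fix t
      have "0 \<le> 2 * h * (1 + 2 * Y \<omega>)" using h by (simp add: Y_def)
      then show "ennreal ((shifted_process W k \<omega> t - step_path h k d t)\<^sup>2) * indicator {0..T} t \<le>
        ennreal (2 * (modification (k + t) \<omega> - modification (g t) \<omega>)\<^sup>2) * indicator {0..T} t
        + ennreal (2 * h * (1 + 2 * Y \<omega>)) * indicator {0..T} t"
        using pt[of t] by (auto simp: indicator_def ennreal_plus[symmetric] simp del: ennreal_plus intro!: ennreal_leI)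
    qed
    also have "\<dots> = I \<omega> + ennreal (2 * h * (1 + 2 * Y \<omega>)) * ennreal T"
      unfolding I_def using T by (subst nn_integral_add) (auto simp: nn_integral_cmult_indicator)
    also have "ennreal (2 * h * (1 + 2 * Y \<omega>)) * ennreal T = ennreal (2 * h * T) * (1 + 2 * ennreal (Y \<omega>))"
    proof -
      have Y0: "0 \<le> Y \<omega>" by (simp add: Y_def)
      then have e: "1 + 2 * ennreal (Y \<omega>) = ennreal (1 + 2 * Y \<omega>)"
        by (simp add: ennreal_plus ennreal_mult)
      show ?thesis unfolding e using h T Y0
        by (subst (1 2) ennreal_mult[symmetric]) (auto simp: mult_ac)
    qed
    finally show ?case .
  qed
  also have "\<dots> = (\<integral>\<^sup>+ \<omega>. I \<omega> \<partial>M) + ennreal (2 * h * T) * (1 + 2 * (\<integral>\<^sup>+ \<omega>. ennreal (Y \<omega>) \<partial>M))"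
  proof -
    have [measurable]: "I \<in> borel_measurable M"
    proof -
      have m: "(\<lambda>p. ennreal (2 * (modification (k + fst p) (snd p) - modification (g (fst p)) (snd p))\<^sup>2) * indicator {0..T} (fst p))
          \<in> borel_measurable (lborel \<Otimes>\<^sub>M M)"
        by measurable
      show ?thesis
        unfolding I_def using measurable_compose[OF measurable_pair_swap' m]
        by (intro lborel.borel_measurable_nn_integral) (simp add: case_prod_beta')
    qed
    show ?thesis
      by (simp add: nn_integral_add nn_integral_cmult emeasure_space_1)
  qed
  also have "\<dots> \<le> ennreal (2 * h * T) + ennreal (2 * h * T) * (1 + 2 * 1)"
  proof (intro add_mono mult_left_mono EY order_refl)
    have "(\<integral>\<^sup>+ \<omega>. I \<omega> \<partial>M) = (\<integral>\<^sup>+ t. (\<integral>\<^sup>+ \<omega>. ennreal (2 * (modification (k + t) \<omega> - modification (g t) \<omega>)\<^sup>2) * indicator {0..T} t \<partial>M) \<partial>lborel)"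
      unfolding I_def by (rule Fubini') (unfold case_prod_beta, measurable)
    also have "\<dots> \<le> (\<integral>\<^sup>+ t. ennreal (2 * h) * indicator {0..T} t \<partial>lborel)"
    proof (rule nn_integral_mono)
      fix t
      show "(\<integral>\<^sup>+ \<omega>. ennreal (2 * (modification (k + t) \<omega> - modification (g t) \<omega>)\<^sup>2) * indicator {0..T} t \<partial>M) \<le> ennreal (2 * h) * indicator {0..T} t"
      proof (cases "t \<in> {0..T}")
        case True
        note gt = g[OF True]
        have [measurable]: "W (k + t) \<in> borel_measurable M" "W (g t) \<in> borel_measurable M"
          using True k gt by (auto intro!: random_variable_W)
        have "(\<integral>\<^sup>+ \<omega>. ennreal (2 * (modification (k + t) \<omega> - modification (g t) \<omega>)\<^sup>2) \<partial>M) =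
          (\<integral>\<^sup>+ \<omega>. 2 * ennreal ((W (k + t) \<omega> - W (g t) \<omega>)\<^sup>2) \<partial>M)"
          by (rule nn_integral_cong_AE, use AE_continuous_modification in eventually_elim)
            (use True k gt in \<open>auto simp: ennreal_mult\<close>)
        also have "\<dots> = 2 * ennreal (k + t - g t)"
          using gt by (subst nn_integral_cmult) (auto simp: nn_integral_increment_square)
        also have "\<dots> \<le> ennreal (2 * h)"
          using gt by (simp add: ennreal_mult ennreal_leI mult_left_mono)
        finally show ?thesis using True by simp
      qed simp
    qed
    also have "\<dots> = ennreal (2 * h * T)"
      using T h by (subst nn_integral_cmult_indicator) (auto simp: ennreal_mult[symmetric])
    finally show "(\<integral>\<^sup>+ \<omega>. I \<omega> \<partial>M) \<le> ennreal (2 * h * T)" .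
  qed simp_all
  also have "\<dots> = ennreal (2 * h * T + 2 * h * T * 3)"
  proof -
    have e: "1 + 2 * 1 = ennreal 3" by simp
    show ?thesis
      unfolding e using T h
      by (subst ennreal_mult[symmetric], simp, simp, subst ennreal_plus[symmetric]) auto
  qed
  also have "2 * h * T + 2 * h * T * 3 = 8 * T * (k + T) / real m"
    by (simp add: h_def)
  finally show ?thesis using \<alpha> by blast
qed

text \<open>Take \<open>m\<close> as large as \<open>48\<^sup>m \<le> n\<close> permits, up to constants.\<close>

lemma quantization_error_upper:
  assumes T: "0 < T" and k: "0 \<le> k" and n: "2 ^ 16 \<le> n"
  shows "quantization_error T M (shifted_process W k) n \<le> sqrt (128 * T * (k + T)) * ln (real n) powr (- 1 / 2)"
proof -
  define L where "L = ln (real n)"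
  have "8 \<le> 16 * ln (2 :: real)"
    using ln2_ge_two_thirds by linarith
  also have "\<dots> = ln (2 ^ 16)" by (subst ln_realpow) auto
  also have "\<dots> \<le> L"
    unfolding L_def using n by (subst ln_le_cancel_iff) auto
  finally have L: "8 \<le> L" .
  \<comment> \<open>Since \<open>48 \<le> 2\<^sup>8 \<le> e\<^sup>8\<close>, this gives \<open>48\<^sup>m \<le> n\<close>.\<close>
  define m where "m = nat \<lfloor>L / 8\<rfloor>"
  have m: "1 \<le> m" "real m \<le> L / 8" "L / 16 \<le> real m"
  proof -
    have f1: "1 \<le> \<lfloor>L / 8\<rfloor>" using L by (simp add: le_floor_iff)
    have f2: "L / 8 - 1 < real_of_int \<lfloor>L / 8\<rfloor>" by linarith
    note f = f1 f2 of_int_floor_le[of "L / 8"]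
    then have r: "real m = real_of_int \<lfloor>L / 8\<rfloor>" by (simp add: m_def)
    show "1 \<le> m" using f(1) unfolding m_def by linarith
    show "real m \<le> L / 8" using f r by simp
    have "1 \<le> real_of_int \<lfloor>L / 8\<rfloor>" using f(1) by linarith
    then show "L / 16 \<le> real m" using f(2) unfolding r by linarith
  qed
  obtain \<alpha> where \<alpha>: "\<alpha> \<subseteq> L2_space T" "finite \<alpha>" "\<alpha> \<noteq> {}" "card \<alpha> \<le> 48 ^ m"
    and J: "(\<integral>\<^sup>+ \<omega>. ennreal (MIN a\<in>\<alpha>. (L2_norm T (\<lambda>t. shifted_process W k \<omega> t - a t))\<^sup>2) \<partial>M)
      \<le> ennreal (8 * T * (k + T) / real m)"
    using quantization_upper[OF T k m(1)] by blast
  have "(48 :: real) \<le> 2 ^ 8" by simp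
  also have "\<dots> \<le> exp 1 ^ 8"
    using exp_ge_add_one_self[of "1 :: real"] by (intro power_mono) auto
  also have "\<dots> = exp 8" using exp_of_nat_mult[of 8 "1 :: real"] by simp
  finally have "(48 :: real) ^ m \<le> exp 8 ^ m" by (intro power_mono) auto
  also have "\<dots> = exp (real m * 8)" by (rule exp_of_nat_mult[symmetric])
  also have "\<dots> \<le> exp L" using m by simp
  also have "\<dots> = real n" using n by (simp add: L_def)
  finally have "real (48 ^ m) \<le> real n" by (simp only: of_nat_power of_nat_numeral)
  then have "48 ^ m \<le> n" by (simp only: of_nat_le_iff)
  then have card: "card \<alpha> \<le> n" "1 \<le> card \<alpha>"
    using \<alpha> by (auto simp: Suc_le_eq card_gt_0_iff)
  have "quantization_error T M (shifted_process W k) n \<le>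
    sqrt (enn2real (\<integral>\<^sup>+ \<omega>. ennreal (MIN a\<in>\<alpha>. (L2_norm T (\<lambda>t. shifted_process W k \<omega> t - a t))\<^sup>2) \<partial>M))"
    unfolding quantization_error_def
    by (rule cINF_lower[OF bdd_belowI2[of _ 0]]) (use \<alpha> card in auto)
  also have "\<dots> \<le> sqrt (8 * T * (k + T) / real m)"
    using enn2real_mono[OF J] T k by simp
  also have "\<dots> \<le> sqrt (8 * T * (k + T) / (L / 16))"
    using m L T k by (intro real_sqrt_le_mono divide_left_mono) auto
  also have "8 * T * (k + T) / (L / 16) = 128 * T * (k + T) / L" by simp
  also have "sqrt (128 * T * (k + T) / L) = sqrt (128 * T * (k + T)) * L powr (- 1 / 2)"
    using L powr_neg_half[of L] by (simp only: real_sqrt_divide) simp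
  finally show ?thesis by (simp add: L_def)
qed

end

section \<open>Eigenvalue and quantization rates\<close>

theorem theorem4:
  fixes T k :: real
  assumes "T > 0" and "k \<ge> 0"
  shows
    "(\<exists>c C. 0 < c \<and> c \<le> C \<and>
       (\<forall>(M :: 'a measure) W. wiener_process M W \<longrightarrow>
         (\<forall>l\<ge>1.
           c * real l powr (-2)
             \<le> ordered_eigenvalue T (covariance_operator T M (shifted_process W k)) l \<and>
           ordered_eigenvalue T (covariance_operator T M (shifted_process W k)) l
             \<le> C * real l powr (-2)))) \<and>
     (\<exists>c' C' n0. 0 < c' \<and> c' \<le> C' \<and> 2 \<le> n0 \<and>
       (\<forall>(M :: 'a measure) W. wiener_process M W \<longrightarrow>
         (\<forall>n\<ge>n0.
           c' * ln (real n) powr (-1/2)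
             \<le> quantization_error T M (shifted_process W k) n \<and>
           quantization_error T M (shifted_process W k) n
             \<le> C' * ln (real n) powr (-1/2))))"
proof (rule conjI)
  obtain c C where cC: "0 < c" "c \<le> C"
    "\<And>l. 1 \<le> l \<Longrightarrow> c * real l powr (- 2) \<le> (T / tan_root (k / T) (l - 1))\<^sup>2"
    "\<And>l. 1 \<le> l \<Longrightarrow> (T / tan_root (k / T) (l - 1))\<^sup>2 \<le> C * real l powr (- 2)"
    using brownian_eigenvalue_bounds[OF assms] by blast
  show "\<exists>c C. 0 < c \<and> c \<le> C \<and>
       (\<forall>(M :: 'a measure) W. wiener_process M W \<longrightarrow>
         (\<forall>l\<ge>1.
           c * real l powr (-2)
             \<le> ordered_eigenvalue T (covariance_operator T M (shifted_process W k)) l \<and>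
           ordered_eigenvalue T (covariance_operator T M (shifted_process W k)) l
             \<le> C * real l powr (-2)))"
  proof (rule exI[of _ c], rule exI[of _ C], intro conjI allI impI cC(1,2))
    fix M :: "'a measure" and W and l :: nat
    assume W: "wiener_process M W" and l: "1 \<le> l"
    note eq = wiener_process.ordered_eigenvalue_shifted_process[OF W assms l]
    show "c * real l powr (-2)
        \<le> ordered_eigenvalue T (covariance_operator T M (shifted_process W k)) l"
      unfolding eq by (rule cC(3)[OF l])
    show "ordered_eigenvalue T (covariance_operator T M (shifted_process W k)) l
        \<le> C * real l powr (-2)"
      unfolding eq by (rule cC(4)[OF l])
  qed
next
  have pos: "0 < sqrt (T\<^sup>2 / 288)" using assms by simp
  have "T * T / 288 \<le> T * T" by simp
  also have "T * T \<le> 128 * T * (k + T)"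
    using assms by (intro mult_mono) auto
  finally have le: "sqrt (T\<^sup>2 / 288) \<le> sqrt (128 * T * (k + T))"
    by (simp add: power2_eq_square)
  show "\<exists>c' C' n0. 0 < c' \<and> c' \<le> C' \<and> 2 \<le> n0 \<and>
       (\<forall>(M :: 'a measure) W. wiener_process M W \<longrightarrow>
         (\<forall>n\<ge>n0.
           c' * ln (real n) powr (-1/2)
             \<le> quantization_error T M (shifted_process W k) n \<and>
           quantization_error T M (shifted_process W k) n
             \<le> C' * ln (real n) powr (-1/2)))"
  proof (rule exI[of _ "sqrt (T\<^sup>2 / 288)"], rule exI[of _ "sqrt (128 * T * (k + T))"], rule exI[of _ "2 ^ 16"],
      intro conjI allI impI pos le)
    show "(2 :: nat) \<le> 2 ^ 16" by simp
    fix M :: "'a measure" and W and n :: nat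
    assume W: "wiener_process M W" and n: "2 ^ 16 \<le> n"
    then have "3 \<le> n" by simp
    then show "sqrt (T\<^sup>2 / 288) * ln (real n) powr (-1/2)
        \<le> quantization_error T M (shifted_process W k) n"
      by (rule wiener_process.quantization_error_lower[OF W assms])
    show "quantization_error T M (shifted_process W k) n
        \<le> sqrt (128 * T * (k + T)) * ln (real n) powr (-1/2)"
      by (rule wiener_process.quantization_error_upper[OF W assms n])
  qed
qed

end
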